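(* (i) The ring $\mathbf Z[\![X]\!]$ has polynomial submodule growth. (ii) $\zeta_{\mathbf Z[\![X]\!]}(s) = \prod_{j=1}^\infty \zeta(js - j + 1)$ for $\mathrm{Re}(s) > 1$.
   Context: A commutative unital ring $R$ has polynomial submodule growth if for every finitely generated $R$-module $M$: for each $m\ge1$, the number of submodules of $M$ of additive index $m$ is finite and polynomially bounded as a function of $m$. $\mathbf Z[\![X]\!]$ is the ring of formal power series over $\mathbf Z$. For a ring $R$ with polynomial submodule growth, $\zeta_R(s)=\sum_I|R:I|^{-s}$, the sum over ideals $I$ of $R$ of finite index, is its ideal zeta function. $\zeta(s)$ is the Riemann zeta function. *)

theory Defs
  imports "HOL-Analysis.Analysis"
begin

text \<open>
  Rings are types of class \<open>comm_ring_1\<close>. A module over such a ring is an instance of the library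
  locale \<open>module\<close>: a scalar multiplication on a type of class \<open>ab_group_add\<close>. Submodules are then
  \<open>module.subspace\<close> and generated submodules \<open>module.span\<close>.
\<close>

definition cosets :: "'a::ab_group_add set \<Rightarrow> 'a set set" where
  "cosets N = range (\<lambda>x. (+) x ` N)"

text \<open>As \<open>card\<close> of an infinite set is 0, the value 0 means that the index is infinite;
  a finite index is always at least 1.\<close>

definition additive_index :: "'a::ab_group_add set \<Rightarrow> nat" where
  "additive_index N = card (cosets N)"

definition finitely_generated_module :: "('r::comm_ring_1 \<Rightarrow> 'm::ab_group_add \<Rightarrow> 'm) \<Rightarrow> bool" where
  "finitely_generated_module scl \<longleftrightarrow>
     module scl \<and> (\<exists>B. finite B \<and> module.span scl B = UNIV)"

definition submodules_of_index ::
  "('r::comm_ring_1 \<Rightarrow> 'm::ab_group_add \<Rightarrow> 'm) \<Rightarrow> nat \<Rightarrow> 'm set set" where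
  "submodules_of_index scl m = {N. module.subspace scl N \<and> additive_index N = m}"

text \<open>HOL cannot quantify over types inside a definition, so the type of the underlying groups of
  the modules is a parameter. The notion for all modules is obtained by leaving \<open>'m\<close>
  as a free type variable in the theorem.\<close>

definition polynomial_submodule_growth :: "'r::comm_ring_1 itself \<Rightarrow> 'm::ab_group_add itself \<Rightarrow> bool" where
  "polynomial_submodule_growth _ _ \<longleftrightarrow>
     (\<forall>scl :: 'r \<Rightarrow> 'm \<Rightarrow> 'm. finitely_generated_module scl \<longrightarrow>
        (\<forall>m\<ge>1. finite (submodules_of_index scl m)) \<and>
        (\<exists>C k :: nat. \<forall>m\<ge>1. card (submodules_of_index scl m) \<le> C * m ^ k))"

text \<open>An ideal is a submodule of the ring, regarded as a module over itself.\<close>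

definition finite_index_ideals :: "'r::comm_ring_1 set set" where
  "finite_index_ideals = {I. module.subspace (*) I \<and> finite (cosets I)}"

lemma module_times: "module ((*) :: 'r::comm_ring_1 \<Rightarrow> 'r \<Rightarrow> 'r)"
  by standard (simp_all add: algebra_simps)

lemma finite_index_ideals_iff:
  "I \<in> finite_index_ideals \<longleftrightarrow>
     0 \<in> I \<and> (\<forall>x\<in>I. \<forall>y\<in>I. x + y \<in> I) \<and> (\<forall>r. \<forall>x\<in>I. r * x \<in> I) \<and> finite (cosets I)"
  by (auto simp: finite_index_ideals_def module.subspace_def[OF module_times])

text \<open>Unordered sum; its value is only meaningful where the summands are summable.\<close>

definition ideal_zeta :: "'r::comm_ring_1 itself \<Rightarrow> complex \<Rightarrow> complex" where
  "ideal_zeta _ s =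
     (\<Sum>\<^sub>\<infinity>I\<in>(finite_index_ideals :: 'r set set). of_nat (additive_index I) powr (- s))"

text \<open>The Dirichlet series of the Riemann zeta function. It is the zeta function for \<open>Re s > 1\<close>,
  and no other arguments occur: \<open>Re (j * s - j + 1) = j * (Re s - 1) + 1 > 1\<close> for
  \<open>Re s > 1\<close> and \<open>j \<ge> 1\<close>.\<close>

definition riemann_zeta :: "complex \<Rightarrow> complex" where
  "riemann_zeta s = (\<Sum>n. of_nat (Suc n) powr (- s))"

end

theory Submission
  imports Defs
begin

unbundle no vec_syntax
unbundle fps_syntax

text \<open>
  Let \<open>N\<close> be a finite-index subgroup of \<open>\<int>[[X]]\<close> that is stable under \<open>X\<^sup>r\<close> and contains \<open>X\<^sup>n \<int>[[X]]\<close>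
  for some \<open>n\<close>; for \<open>r = 1\<close> these are the finite-index ideals, and in general they are the finite-index submodules of a free module of
  rank \<open>r\<close>. Put \<open>N' = {f. X f \<in> N}\<close>, and let \<open>d\<^sub>i\<close> be the positive generator of the constant terms
  of \<open>{f. X\<^sup>i f \<in> N}\<close>. The index of \<open>N\<close> is \<open>d\<^sub>0\<close> times that of \<open>N'\<close>, \<open>d\<^sub>r\<close> divides \<open>d\<^sub>0\<close>, and since
  \<open>N = \<int> f + X N'\<close> for any \<open>f \<in> N\<close> with constant term \<open>d\<^sub>0\<close>, exactly \<open>d\<^sub>1 \<cdots> d\<^sub>r\<close> subgroups \<open>N\<close> share
  given \<open>N'\<close> and \<open>d\<^sub>0\<close>. With the weight \<open>|N|\<^bsup>-r\<theta>\<^esup> \<Prod>i<r. d\<^sub>i\<^bsup>-(a + i\<theta>)\<^esup>\<close> this makes the sum over \<open>N\<close> equal to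
  \<open>\<zeta>(r\<theta> + a)\<close> times the same sum over \<open>N'\<close> with \<open>a\<close> replaced by \<open>a + \<theta> - 1\<close>. Iteration gives
  \<open>\<Prod>j. \<zeta>(r\<theta> + a + j(\<theta> - 1))\<close>. For \<open>r = 1\<close>, \<open>a = 0\<close> this is the formula for the zeta function; for
  \<open>\<theta> = 2\<close>, \<open>a = 0\<close> its convergence bounds the number of submodules of index \<open>m\<close> by a multiple of
  \<open>m\<^bsup>4r\<^esup>\<close>.
\<close>

subsection \<open>Additive subgroups and their index\<close>

definition add_subgroup :: "'a::ab_group_add set \<Rightarrow> bool" where
  "add_subgroup N \<longleftrightarrow> 0 \<in> N \<and> (\<forall>x\<in>N. \<forall>y\<in>N. x - y \<in> N)"

lemma add_subgroup_0: "add_subgroup N \<Longrightarrow> 0 \<in> N"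
  by (simp add: add_subgroup_def)

lemma add_subgroup_diff: "add_subgroup N \<Longrightarrow> x \<in> N \<Longrightarrow> y \<in> N \<Longrightarrow> x - y \<in> N"
  by (simp add: add_subgroup_def)

lemma add_subgroup_uminus: "add_subgroup N \<Longrightarrow> x \<in> N \<Longrightarrow> - x \<in> N"
  using add_subgroup_diff[of N 0 x] add_subgroup_0[of N] by simp

lemma add_subgroup_add: "add_subgroup N \<Longrightarrow> x \<in> N \<Longrightarrow> y \<in> N \<Longrightarrow> x + y \<in> N"
  using add_subgroup_diff[of N x "- y"] add_subgroup_uminus[of N y] by simp

lemma add_subgroup_of_nat_mult:
  "add_subgroup N \<Longrightarrow> x \<in> N \<Longrightarrow> of_nat k * x \<in> (N :: 'a::comm_ring_1 set)"
  by (induction k) (auto simp: algebra_simps add_subgroup_0 add_subgroup_add)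

lemma add_subgroup_of_int_mult:
  fixes N :: "'a::comm_ring_1 set"
  assumes "add_subgroup N" "x \<in> N"
  shows "of_int k * x \<in> N"
proof (cases "k \<ge> 0")
  case True
  then show ?thesis using add_subgroup_of_nat_mult[OF assms, of "nat k"] by simp
next
  case False
  then have "of_int k * x = - (of_nat (nat (- k)) * x)" by simp
  then show ?thesis
    using add_subgroup_uminus[OF assms(1) add_subgroup_of_nat_mult[OF assms, of "nat (- k)"]] by simp
qed

lemma coset_eq_iff:
  assumes "add_subgroup N"
  shows "(+) x ` N = (+) y ` N \<longleftrightarrow> x - y \<in> N"
proof
  assume "(+) x ` N = (+) y ` N"
  moreover have "x + 0 \<in> (+) x ` N" using assms by (intro imageI add_subgroup_0)
  ultimately have "x + 0 \<in> (+) y ` N" by simp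
  then show "x - y \<in> N" by auto
next
  assume h: "x - y \<in> N"
  have sub: "(+) u ` N \<subseteq> (+) v ` N" if "u - v \<in> N" for u v
  proof
    fix z assume "z \<in> (+) u ` N"
    then obtain w where "w \<in> N" "z = u + w" by auto
    then have "z = v + ((u - v) + w)" "(u - v) + w \<in> N"
      using that assms by (auto intro: add_subgroup_add)
    then show "z \<in> (+) v ` N" by blast
  qed
  have "y - x \<in> N" using add_subgroup_uminus[OF assms h] by simp
  then show "(+) x ` N = (+) y ` N" using sub h by blast
qed

text \<open>The assignment \<open>f x \<mapsto> g x\<close> is well defined and injective because
  \<open>f\<close> and \<open>g\<close> identify the same pairs of points.\<close>

lemma ex_bij_betw_ranges:
  assumes "\<And>x y. f x = f y \<longleftrightarrow> g x = g y"
  shows "\<exists>h. bij_betw h (range f) (range g)"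
proof -
  have "bij_betw (\<lambda>c. g (SOME x. f x = c)) (range f) (range g)"
  proof -
    have *: "g (SOME y. f y = f x) = g x" for x
      using assms someI[of "\<lambda>y. f y = f x" x] by blast
    show ?thesis
      unfolding bij_betw_def inj_on_def using assms * by (auto simp: image_image)
  qed
  then show ?thesis by blast
qed

text \<open>The map \<open>h\<close> induces an isomorphism from the quotient by the preimage onto
  the quotient by \<open>N\<close>. This is how submodules of a finitely generated module are pulled
  back to a free one.\<close>

lemma additive_index_vimage:
  fixes h :: "'a::ab_group_add \<Rightarrow> 'b::ab_group_add"
  assumes "surj h" and hdiff: "\<And>x y. h (x - y) = h x - h y"
    and "add_subgroup N"
  shows "additive_index (h -` N) = additive_index N"
    and "add_subgroup (h -` N)"
proof -
  have h0: "h 0 = 0" using hdiff[of 0 0] by simp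
  show sg: "add_subgroup (h -` N)"
    using assms(3) h0 by (auto simp: add_subgroup_def hdiff)
  have "\<exists>b. bij_betw b (range (\<lambda>x. (+) x ` (h -` N))) (range (\<lambda>x. (+) (h x) ` N))"
    by (rule ex_bij_betw_ranges)
      (simp add: coset_eq_iff[OF sg] coset_eq_iff[OF assms(3)] hdiff)
  moreover have "range (\<lambda>x. (+) (h x) ` N) = cosets N"
    unfolding cosets_def image_image[of "\<lambda>y. (+) y ` N" h UNIV, symmetric] assms(1) ..
  ultimately show "additive_index (h -` N) = additive_index N"
    unfolding additive_index_def cosets_def[of "h -` N"] by (metis bij_betw_same_card)
qed

lemma additive_index_pos: "additive_index N > 0 \<longleftrightarrow> finite (cosets N)"
  by (auto simp: additive_index_def cosets_def card_gt_0_iff)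

lemma additive_index_UNIV [simp]: "additive_index (UNIV :: 'a::ab_group_add set) = 1"
proof -
  have "cosets (UNIV :: 'a set) = {UNIV}"
    unfolding cosets_def by simp
  then show ?thesis by (simp add: additive_index_def)
qed

section \<open>Indices in a tower of subgroups\<close>

definition rel_cosets :: "'a::ab_group_add set \<Rightarrow> 'a set \<Rightarrow> 'a set set" where
  "rel_cosets B A = (\<lambda>x. (+) x ` A) ` B"

lemma coset_add: "(+) x ` (+) y ` A = (+) (x + y :: 'a::ab_group_add) ` A"
  by (force simp: add.assoc image_iff)

text \<open>Every coset of \<open>A\<close> lies in a unique coset \<open>C\<close> of
  \<open>B\<close> and is the translate by \<open>\<rho> C\<close> of a unique coset of
  \<open>A\<close> inside \<open>B\<close>. Infinite indices are covered as well, since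
  \<open>card\<close> is multiplicative on products with the value 0 for infinite sets.\<close>

lemma additive_index_mult:
  assumes A: "add_subgroup A" and B: "add_subgroup B" and "A \<subseteq> B"
  shows "additive_index A = card (rel_cosets B A) * additive_index B"
proof -
  define \<rho> where "\<rho> C = (SOME x. x \<in> C)" for C :: "'a set"
  have \<rho>: "\<rho> C \<in> C" "(+) (\<rho> C) ` B = C" if C: "C \<in> cosets B" for C
  proof -
    obtain x where x: "C = (+) x ` B" using C unfolding cosets_def by blast
    then have "x + 0 \<in> C" using add_subgroup_0[OF B] by blast
    then show "\<rho> C \<in> C" unfolding \<rho>_def by (rule someI)
    then have "\<rho> C - x \<in> B" using x by auto
    then show "(+) (\<rho> C) ` B = C" using x coset_eq_iff[OF B] by simp
  qed
  have "bij_betw (\<lambda>(C, D). (+) (\<rho> C) ` D) (cosets B \<times> rel_cosets B A) (cosets A)"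
  proof (rule bij_betw_imageI)
    show "inj_on (\<lambda>(C, D). (+) (\<rho> C) ` D) (cosets B \<times> rel_cosets B A)"
    proof (rule inj_onI, clarsimp)
      fix C D C' D' assume h: "C \<in> cosets B" "C' \<in> cosets B" "D \<in> rel_cosets B A" "D' \<in> rel_cosets B A"
        and eq: "(+) (\<rho> C) ` D = (+) (\<rho> C') ` D'"
      obtain b b' where b: "b \<in> B" "D = (+) b ` A" "b' \<in> B" "D' = (+) b' ` A"
        using h by (auto simp: rel_cosets_def)
      have "(+) (\<rho> C + b) ` A = (+) (\<rho> C' + b') ` A"
        using eq b by (simp add: coset_add)
      then have d: "(\<rho> C + b) - (\<rho> C' + b') \<in> A" using coset_eq_iff[OF A] by blast
      then have "(\<rho> C + b) - (\<rho> C' + b') \<in> B" using assms(3) by blast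
      then have "((\<rho> C + b) - (\<rho> C' + b')) + (b' - b) \<in> B"
        using add_subgroup_add[OF B] add_subgroup_diff[OF B b(3,1)] by blast
      then have "\<rho> C - \<rho> C' \<in> B" by simp
      then have "C = C'" using \<rho>(2)[OF h(1)] \<rho>(2)[OF h(2)] coset_eq_iff[OF B, of "\<rho> C" "\<rho> C'"] by simp
      moreover from this have "b - b' \<in> A" using d by simp
      ultimately show "C = C' \<and> D = D'" using b coset_eq_iff[OF A, of b b'] by simp
    qed
    show "(\<lambda>(C, D). (+) (\<rho> C) ` D) ` (cosets B \<times> rel_cosets B A) = cosets A"
    proof (intro equalityI subsetI)
      fix c assume "c \<in> (\<lambda>(C, D). (+) (\<rho> C) ` D) ` (cosets B \<times> rel_cosets B A)"
      then obtain C b where "c = (+) (\<rho> C) ` ((+) b ` A)"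
        by (auto simp: rel_cosets_def)
      then have "c = (+) (\<rho> C + b) ` A" by (simp add: coset_add)
      then show "c \<in> cosets A" by (auto simp: cosets_def)
    next
      fix c assume "c \<in> cosets A"
      then obtain x where x: "c = (+) x ` A" by (auto simp: cosets_def)
      define C where "C = (+) x ` B"
      have C: "C \<in> cosets B" by (auto simp: cosets_def C_def)
      have "x - \<rho> C \<in> B" using \<rho>(2)[OF C] C_def coset_eq_iff[OF B, of x "\<rho> C"] by simp
      then have "(+) (x - \<rho> C) ` A \<in> rel_cosets B A" by (auto simp: rel_cosets_def)
      moreover have "c = (+) (\<rho> C) ` ((+) (x - \<rho> C) ` A)"
        by (simp add: x coset_add)
      ultimately show "c \<in> (\<lambda>(C, D). (+) (\<rho> C) ` D) ` (cosets B \<times> rel_cosets B A)"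
        using C by (intro image_eqI[of _ _ "(C, (+) (x - \<rho> C) ` A)"]) auto
    qed
  qed
  from bij_betw_same_card[OF this] show ?thesis
    by (simp add: additive_index_def card_cartesian_product mult.commute)
qed

text \<open>Division with remainder by the least positive element; the trivial subgroup is the case
  \<open>d = 0\<close>.\<close>

lemma int_subgroup_dvd:
  assumes "add_subgroup (L :: int set)"
  shows "\<exists>d. L = {x. d dvd x}"
proof (cases "\<exists>x\<in>L. x > 0")
  case False
  have "x = 0" if x: "x \<in> L" for x
  proof -
    have "\<not> x > 0" "\<not> - x > 0" using False x add_subgroup_uminus[OF assms x] by blast+
    then show ?thesis by simp
  qed
  then have "L = {x. 0 dvd x}" using add_subgroup_0[OF assms] by auto
  then show ?thesis by blast
next
  case True
  define k where "k = (LEAST k. k > 0 \<and> int k \<in> L)"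
  obtain x where x: "x > 0" "x \<in> L" using True by blast
  then have ex: "nat x > 0 \<and> int (nat x) \<in> L" by simp
  have k: "k > 0" "int k \<in> L" using LeastI[of "\<lambda>k. k > 0 \<and> int k \<in> L", OF ex] by (auto simp: k_def)
  have "int k dvd y" if "y \<in> L" for y
  proof (rule ccontr)
    assume "\<not> int k dvd y"
    then have "y mod int k \<noteq> 0" by (simp add: mod_eq_0_iff_dvd)
    moreover have "y mod int k \<ge> 0" using k by simp
    ultimately have pos: "y mod int k > 0" by linarith
    have "y - of_int (y div int k) * int k \<in> L"
      by (intro add_subgroup_diff add_subgroup_of_int_mult assms that k)
    then have "y mod int k \<in> L" by (simp add: minus_div_mult_eq_mod)
    with pos have "k \<le> nat (y mod int k)" unfolding k_def by (intro Least_le) simp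
    moreover have "y mod int k < int k" using k(1) by simp
    ultimately show False using pos by linarith
  qed
  moreover have "y \<in> L" if dvd: "int k dvd y" for y
  proof -
    obtain l where "y = int k * l" using dvd by (elim dvdE)
    then show ?thesis using add_subgroup_of_int_mult[OF assms k(2), of l] by (simp add: mult.commute)
  qed
  ultimately show ?thesis by blast
qed

subsection \<open>Subgroups of \<open>\<int>[[X]]\<close> stable under a power of \<open>X\<close>\<close>

text \<open>The leading number generates the group of constant terms, so it is \<open>0\<close> if they all vanish.\<close>

definition lead :: "int fps set \<Rightarrow> nat" where
  "lead N = nat (Gcd ((\<lambda>f. f $ 0) ` N))"

definition shift :: "int fps set \<Rightarrow> int fps set" where
  "shift N = {f. fps_X * f \<in> N}"

text \<open>The constant terms form a subgroup of the integers, hence they are the multiples of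
  their gcd. This supplies elements of \<open>N\<close> with prescribed constant term.\<close>

lemma lead_dvd_iff:
  assumes "add_subgroup N"
  shows "int (lead N) dvd c \<longleftrightarrow> (\<exists>f\<in>N. f $ 0 = c)"
proof -
  have "add_subgroup ((\<lambda>f. f $ 0) ` N)"
    unfolding add_subgroup_def
  proof (intro conjI ballI)
    show "0 \<in> (\<lambda>f. f $ 0) ` N" using add_subgroup_0[OF assms] by (intro image_eqI[of _ _ 0]) auto
    fix x y assume "x \<in> (\<lambda>f. f $ 0) ` N" "y \<in> (\<lambda>f. f $ 0) ` N"
    then obtain f g where "f \<in> N" "g \<in> N" "x = f $ 0" "y = g $ 0" by auto
    then show "x - y \<in> (\<lambda>f. f $ 0) ` N"
      by (intro image_eqI[of _ _ "f - g"] add_subgroup_diff[OF assms]) simp_all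
  qed
  from int_subgroup_dvd[OF this] obtain d where d: "(\<lambda>f. f $ 0) ` N = {x. d dvd x}" by blast
  have "Gcd {x. d dvd x} dvd d" by (intro Gcd_dvd) simp
  moreover have "d dvd Gcd {x. d dvd x}" by (intro Gcd_greatest) simp
  ultimately have "Gcd {x. d dvd x} = \<bar>d\<bar>" by (intro zdvd_antisym_nonneg) simp_all
  then have "int (lead N) = \<bar>d\<bar>" by (simp add: lead_def d)
  then have "int (lead N) dvd c \<longleftrightarrow> d dvd c" by simp
  also have "\<dots> \<longleftrightarrow> c \<in> (\<lambda>f. f $ 0) ` N" by (simp add: d)
  finally show ?thesis by auto
qed

lemma lead_eqI:
  assumes "add_subgroup N" "\<And>c. (\<exists>f\<in>N. f $ 0 = c) \<longleftrightarrow> int d dvd c"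
  shows "lead N = d"
proof -
  have "int (lead N) dvd c \<longleftrightarrow> int d dvd c" for c
    using lead_dvd_iff[OF assms(1)] assms(2) by simp
  then have "lead N dvd d" "d dvd lead N"
    by (metis dvd_refl int_dvd_int_iff)+
  then show ?thesis by (simp add: dvd_antisym)
qed

lemma add_subgroup_shift: "add_subgroup N \<Longrightarrow> add_subgroup (shift N)"
  by (auto simp: add_subgroup_def shift_def right_diff_distrib)

lemma add_subgroup_shift_funpow: "add_subgroup N \<Longrightarrow> add_subgroup ((shift ^^ k) N)"
  by (induction k) (auto simp: add_subgroup_shift)

text \<open>Identifies \<open>lead ((shift ^^ i) N)\<close> with the number \<open>d_i\<close> of
  the overview.\<close>

lemma shift_funpow_iff: "f \<in> (shift ^^ k) N \<longleftrightarrow> fps_X ^ k * f \<in> N"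
  by (induction k arbitrary: f) (simp_all add: shift_def mult_ac)

lemma fps_nth_0_eq_0D: "f $ 0 = 0 \<Longrightarrow> f = fps_X * fps_shift 1 (f :: int fps)"
  by (rule fps_ext) auto

lemma fps_of_int_mult_nth: "(of_int k * f) $ n = k * (f $ n :: int)"
  by (simp flip: fps_of_int)

lemma fps_of_int_nth_0: "(of_int k :: int fps) $ 0 = k"
  by (simp flip: fps_of_int)

text \<open>If \<open>lead N > 0\<close>, a series can be brought modulo \<open>N\<close> to the
  form \<open>i + fps_X * h\<close> with \<open>0 \<le> i < lead N\<close>; here \<open>i\<close> is
  unique and \<open>h\<close> is unique modulo \<open>shift N\<close>.\<close>

lemma additive_index_shift:
  assumes N: "add_subgroup N"
  shows "additive_index N = lead N * additive_index (shift N)"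
proof -
  define d where "d = int (lead N)"
  have S: "add_subgroup (shift N)" using N by (rule add_subgroup_shift)
  have d: "d dvd c \<longleftrightarrow> (\<exists>f\<in>N. f $ 0 = c)" for c unfolding d_def using lead_dvd_iff[OF N] .
  show ?thesis
  proof (cases "lead N = 0")
    case True
    \<comment> \<open>All constant terms in \<open>N\<close> vanish, so distinct integers lie in
      distinct cosets; both sides of the claim are 0 by the convention for infinite index.\<close>
    have "inj (\<lambda>k::int. (+) (of_int k) ` N)"
    proof (rule injI)
      fix k l :: int assume "(+) (of_int k) ` N = (+) (of_int l) ` N"
      then have "of_int k - of_int l \<in> N" using coset_eq_iff[OF N] by blast
      moreover have "(of_int k - of_int l :: int fps) $ 0 = k - l" by (simp add: fps_of_int_nth_0)
      ultimately have "d dvd k - l" using d by blast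
      then show "k = l" using True by (simp add: d_def)
    qed
    moreover have "range (\<lambda>k::int. (+) (of_int k) ` N) \<subseteq> cosets N" by (auto simp: cosets_def)
    ultimately have "infinite (cosets N)"
      by (metis finite_subset infinite_UNIV_char_0 finite_imageD)
    then show ?thesis using True by (simp add: additive_index_def)
  next
    case False
    define \<rho> where "\<rho> C = (SOME x. x \<in> C)" for C :: "int fps set"
    have \<rho>: "(+) (\<rho> C) ` shift N = C" if C: "C \<in> cosets (shift N)" for C
    proof -
      obtain x where x: "C = (+) x ` shift N" using C unfolding cosets_def by blast
      then have "x + 0 \<in> C" using add_subgroup_0[OF S] by blast
      then have "\<rho> C \<in> C" unfolding \<rho>_def by (rule someI)
      then have "\<rho> C - x \<in> shift N" using x by auto
      then show "(+) (\<rho> C) ` shift N = C" using x coset_eq_iff[OF S] by simp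
    qed
    have "bij_betw (\<lambda>(i, C). (+) (of_int i + fps_X * \<rho> C) ` N) ({0..<d} \<times> cosets (shift N)) (cosets N)"
    proof (rule bij_betw_imageI)
      show "inj_on (\<lambda>(i, C). (+) (of_int i + fps_X * \<rho> C) ` N) ({0..<d} \<times> cosets (shift N))"
      proof (rule inj_onI, clarify)
        fix i C j D assume h: "i \<in> {0..<d}" "j \<in> {0..<d}" "C \<in> cosets (shift N)" "D \<in> cosets (shift N)"
          and "(+) (of_int i + fps_X * \<rho> C) ` N = (+) (of_int j + fps_X * \<rho> D) ` N"
        then have m: "(of_int i + fps_X * \<rho> C) - (of_int j + fps_X * \<rho> D) \<in> N"
          using coset_eq_iff[OF N] by blast
        moreover have "((of_int i + fps_X * \<rho> C) - (of_int j + fps_X * \<rho> D)) $ 0 = i - j"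
          by (simp add: fps_of_int_nth_0)
        ultimately have "d dvd i - j" using d by blast
        then have ij: "i = j" using h
          by (metis atLeastLessThan_iff mod_eq_dvd_iff mod_pos_pos_trivial)
        with m have "fps_X * (\<rho> C - \<rho> D) \<in> N" by (simp add: right_diff_distrib)
        then have "\<rho> C - \<rho> D \<in> shift N" by (simp add: shift_def)
        then have "C = D" using \<rho>[OF h(3)] \<rho>[OF h(4)] coset_eq_iff[OF S, of "\<rho> C" "\<rho> D"] by simp
        with ij show "i = j \<and> C = D" by simp
      qed
      show "(\<lambda>(i, C). (+) (of_int i + fps_X * \<rho> C) ` N) ` ({0..<d} \<times> cosets (shift N)) = cosets N"
      proof (intro equalityI subsetI)
        fix c assume "c \<in> cosets N"
        then obtain f where f: "c = (+) f ` N" by (auto simp: cosets_def)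
        define i where "i = f $ 0 mod d"
        have i: "i \<in> {0..<d}" using False by (simp add: i_def d_def)
        have "d dvd f $ 0 - i" by (simp add: i_def)
        then obtain g where g: "g \<in> N" "g $ 0 = f $ 0 - i" using d by blast
        define h where "h = fps_shift 1 (f - g - of_int i)"
        have h: "f - g - of_int i = fps_X * h"
          unfolding h_def by (rule fps_nth_0_eq_0D) (simp add: g fps_of_int_nth_0)
        define C where "C = (+) h ` shift N"
        have C: "C \<in> cosets (shift N)" by (auto simp: C_def cosets_def)
        have "h - \<rho> C \<in> shift N" using \<rho>[OF C] coset_eq_iff[OF S, of h "\<rho> C"] C_def by simp
        then have "fps_X * (h - \<rho> C) + g \<in> N" using g N by (intro add_subgroup_add) (auto simp: shift_def)
        moreover have "fps_X * (h - \<rho> C) + g = f - (of_int i + fps_X * \<rho> C)"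
          using h by (simp add: algebra_simps)
        ultimately have "c = (+) (of_int i + fps_X * \<rho> C) ` N"
          using f coset_eq_iff[OF N, of f "of_int i + fps_X * \<rho> C"] by simp
        then show "c \<in> (\<lambda>(i, C). (+) (of_int i + fps_X * \<rho> C) ` N) ` ({0..<d} \<times> cosets (shift N))"
          using i C by (intro image_eqI[of _ _ "(i, C)"]) auto
      qed (auto simp: cosets_def)
    qed
    from bij_betw_same_card[OF this] show ?thesis
      by (simp add: additive_index_def card_cartesian_product d_def)
  qed
qed

lemma additive_index_shift_funpow:
  assumes "add_subgroup N"
  shows "additive_index N = (\<Prod>i<k. lead ((shift ^^ i) N)) * additive_index ((shift ^^ k) N)"
proof (induction k)
  case (Suc k)
  then show ?case
    using additive_index_shift[OF add_subgroup_shift_funpow[OF assms, of k]] by (simp add: mult.assoc)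
qed simp

section \<open>Stable subgroups and their leading numbers\<close>

definition shift_closed :: "nat \<Rightarrow> nat \<Rightarrow> int fps set set" where
  "shift_closed r n = {N. add_subgroup N \<and> finite (cosets N) \<and>
     (\<forall>f\<in>N. fps_X ^ r * f \<in> N) \<and> (\<forall>f. fps_X ^ n * f \<in> N)}"

lemma shift_closedD:
  assumes "N \<in> shift_closed r n"
  shows "add_subgroup N" "finite (cosets N)" "additive_index N > 0"
    "\<And>f. f \<in> N \<Longrightarrow> fps_X ^ r * f \<in> N" "\<And>f. fps_X ^ n * f \<in> N"
  using assms by (auto simp: shift_closed_def additive_index_pos)

lemma shift_closed_0: "shift_closed r 0 = {UNIV}"
  using additive_index_pos[of "UNIV :: int fps set"]
  by (auto simp: shift_closed_def add_subgroup_def)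

lemma shift_closed_mono:
  assumes "n \<le> m"
  shows "shift_closed r n \<subseteq> shift_closed r m"
proof
  fix N assume N: "N \<in> shift_closed r n"
  have "fps_X ^ m * f \<in> N" for f
  proof -
    have "fps_X ^ m * f = fps_X ^ n * (fps_X ^ (m - n) * f)"
      using assms by (simp flip: power_add mult.assoc)
    then show ?thesis using shift_closedD(5)[OF N] by metis
  qed
  then show "N \<in> shift_closed r m" using N by (simp add: shift_closed_def)
qed

lemma lead_pos:
  assumes "add_subgroup N" "additive_index N > 0"
  shows "lead N > 0" "additive_index (shift N) > 0"
  using additive_index_shift[OF assms(1)] assms(2) by (auto intro: ccontr)

lemma lead_funpow_pos:
  assumes "add_subgroup N" "additive_index N > 0"
  shows "lead ((shift ^^ k) N) > 0" "additive_index ((shift ^^ k) N) > 0"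
proof -
  have "additive_index ((shift ^^ k) N) > 0" for k
    using additive_index_shift_funpow[OF assms(1), of k] assms(2) by (auto intro: ccontr)
  then show "lead ((shift ^^ k) N) > 0" "additive_index ((shift ^^ k) N) > 0"
    using lead_pos(1) add_subgroup_shift_funpow[OF assms(1)] by auto
qed

text \<open>The later induction on \<open>n\<close> rests on this: \<open>shift\<close> lowers the
  bound by one and keeps stability and finite index, and the bound 0 leaves only the whole
  ring.\<close>

lemma shift_shift_closed:
  assumes "N \<in> shift_closed r (Suc n)"
  shows "shift N \<in> shift_closed r n"
  using assms lead_pos(2)[of N]
  by (auto simp: shift_closed_def additive_index_pos add_subgroup_shift)
     (auto simp: shift_def mult.left_commute mult.assoc)

lemma mem_shift_funpow_of_closed:
  assumes "N \<in> shift_closed r n" "f \<in> N"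
  shows "f \<in> (shift ^^ r) N"
  using assms shift_closedD(4) by (simp add: shift_funpow_iff)

section \<open>Counting the stable subgroups with given \<open>shift\<close> and
  \<open>lead\<close>\<close>

definition fibre :: "nat \<Rightarrow> nat \<Rightarrow> int fps set \<Rightarrow> nat \<Rightarrow> int fps set set" where
  "fibre r n N d = {K \<in> shift_closed r (Suc n). shift K = N \<and> lead K = d}"

text \<open>Stability puts \<open>N\<close> inside \<open>(shift ^^ Suc q) N\<close>, so every
  constant term of the former is one of the latter.\<close>

lemma lead_dvd_lead:
  assumes "N \<in> shift_closed (Suc q) (Suc n)"
  shows "lead ((shift ^^ q) (shift N)) dvd lead N"
proof -
  note N = shift_closedD[OF assms]
  obtain f where f: "f \<in> N" "f $ 0 = int (lead N)"
    using lead_dvd_iff[OF N(1), of "int (lead N)"] by auto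
  have "f \<in> (shift ^^ Suc q) N" using mem_shift_funpow_of_closed[OF assms f(1)] .
  then have "f \<in> (shift ^^ q) (shift N)" by (simp only: funpow_Suc_right o_apply)
  then have "int (lead ((shift ^^ q) (shift N))) dvd int (lead N)"
    using lead_dvd_iff[OF add_subgroup_shift_funpow[OF add_subgroup_shift[OF N(1)]]] f(2) by blast
  then show ?thesis by simp
qed

text \<open>For a fixed \<open>f\<close> with constant term \<open>d\<close>, each member of the
  fibre is generated by some \<open>f + fps_X * g\<close> together with \<open>fps_X * N\<close>.
  Stability means \<open>g \<in> S\<close>, and only \<open>g\<close> modulo \<open>N\<close>
  matters, so the members correspond to the cosets of \<open>N\<close> in \<open>S\<close>.\<close>

lemma card_fibre:
  assumes N: "N \<in> shift_closed (Suc q) n" and "d > 0" and dvd: "lead ((shift ^^ q) N) dvd d"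
  shows "card (fibre (Suc q) n N d) = (\<Prod>i<Suc q. lead ((shift ^^ i) N))"
proof -
  note N' = shift_closedD[OF N]
  define S where "S = (shift ^^ Suc q) N"
  have SG: "add_subgroup S" unfolding S_def by (rule add_subgroup_shift_funpow[OF N'(1)])
  have "N \<subseteq> S" unfolding S_def using mem_shift_funpow_of_closed[OF N] by blast
  have mem_S: "g \<in> S \<longleftrightarrow> fps_X ^ q * (fps_X * g) \<in> N" for g
    unfolding S_def shift_funpow_iff by (simp add: mult_ac)
  \<comment> \<open>The divisibility hypothesis yields \<open>f\<close> with
    \<open>fps_X ^ q * f \<in> N\<close>, so that stability of \<open>K g\<close> becomes a
    condition on \<open>g\<close> alone.\<close>
  have "\<exists>f\<in>(shift ^^ q) N. f $ 0 = int d"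
    using lead_dvd_iff[OF add_subgroup_shift_funpow[OF N'(1)], of q "int d"] dvd by simp
  then obtain f where f: "fps_X ^ q * f \<in> N" "f $ 0 = int d"
    by (auto simp: shift_funpow_iff)
  define K where "K g = {of_int k * (f + fps_X * g) + fps_X * h | k h. h \<in> N}" for g
  have K_nth0: "(of_int k * (f + fps_X * g) + fps_X * h) $ 0 = k * int d" for k g h
    by (simp add: fps_of_int_mult_nth f)
  have K_sub: "add_subgroup (K g)" for g
    unfolding add_subgroup_def
  proof (intro conjI ballI)
    show "0 \<in> K g" unfolding K_def using add_subgroup_0[OF N'(1)]
      by (intro CollectI exI[of _ 0] exI[of _ "0::int fps"]) auto
    fix x y assume "x \<in> K g" "y \<in> K g"
    then obtain k h k' h' where
      "x = of_int k * (f + fps_X * g) + fps_X * h" "h \<in> N"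
      "y = of_int k' * (f + fps_X * g) + fps_X * h'" "h' \<in> N" by (auto simp: K_def)
    then have "x - y = of_int (k - k') * (f + fps_X * g) + fps_X * (h - h')" "h - h' \<in> N"
      using add_subgroup_diff[OF N'(1)] by (auto simp: algebra_simps)
    then show "x - y \<in> K g" unfolding K_def by blast
  qed
  have XN_K: "fps_X * h \<in> K g" if "h \<in> N" for g h
    unfolding K_def using that by (intro CollectI exI[of _ 0] exI[of _ h]) auto
  have gen_K: "f + fps_X * g \<in> K g" for g
    unfolding K_def using add_subgroup_0[OF N'(1)]
    by (intro CollectI exI[of _ 1] exI[of _ 0]) auto
  have shift_K: "shift (K g) = N" for g
  proof (intro equalityI subsetI)
    fix h assume "h \<in> shift (K g)"
    then obtain k h' where kh: "fps_X * h = of_int k * (f + fps_X * g) + fps_X * h'" "h' \<in> N"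
      by (auto simp: shift_def K_def)
    have "(fps_X * h) $ 0 = k * int d" unfolding kh(1) K_nth0 ..
    then have "k = 0" using \<open>d > 0\<close> by simp
    with kh show "h \<in> N" by simp
  qed (auto simp: shift_def XN_K)
  have lead_K: "lead (K g) = d" for g
  proof (rule lead_eqI[OF K_sub])
    fix c
    show "(\<exists>f\<in>K g. f $ 0 = c) \<longleftrightarrow> int d dvd c"
    proof
      assume "\<exists>f\<in>K g. f $ 0 = c"
      then show "int d dvd c" by (auto simp: K_def fps_of_int_mult_nth f(2))
    next
      assume "int d dvd c"
      then obtain k where k: "c = int d * k" by (elim dvdE)
      have "of_int k * (f + fps_X * g) \<in> K g"
        using add_subgroup_of_int_mult[OF K_sub gen_K] .
      moreover have "(of_int k * (f + fps_X * g)) $ 0 = c"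
        using k by (simp add: fps_of_int_mult_nth f)
      ultimately show "\<exists>f\<in>K g. f $ 0 = c" by blast
    qed
  qed
  have K_fibre: "K g \<in> fibre (Suc q) n N d" if "g \<in> S" for g
  proof -
    have "additive_index (K g) = d * additive_index N"
      using additive_index_shift[OF K_sub, of g] by (simp add: lead_K shift_K)
    then have "finite (cosets (K g))" using \<open>d > 0\<close> N'(3) by (simp flip: additive_index_pos)
    moreover have "fps_X ^ Suc q * x \<in> K g" if "x \<in> K g" for x
    proof -
      from that obtain k h where x: "x = of_int k * (f + fps_X * g) + fps_X * h" "h \<in> N"
        by (auto simp: K_def)
      have "fps_X ^ q * f + fps_X ^ q * (fps_X * g) \<in> N"
        using f \<open>g \<in> S\<close> mem_S N'(1) by (intro add_subgroup_add) auto
      then have "of_int k * (fps_X ^ q * f + fps_X ^ q * (fps_X * g)) + fps_X ^ Suc q * h \<in> N"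
        using add_subgroup_add[OF N'(1) add_subgroup_of_int_mult[OF N'(1)] N'(4)[OF x(2)]] by blast
      then have "fps_X * (of_int k * (fps_X ^ q * f + fps_X ^ q * (fps_X * g)) + fps_X ^ Suc q * h) \<in> K g"
        by (rule XN_K)
      then show ?thesis unfolding x by (simp add: algebra_simps)
    qed
    moreover have "fps_X ^ Suc n * x \<in> K g" for x
      using XN_K[OF N'(5)[of x], of g] by (simp add: mult.assoc)
    ultimately show ?thesis
      unfolding fibre_def shift_closed_def using K_sub shift_K lead_K by simp
  qed
  have K_eq: "K g = K g' \<longleftrightarrow> g - g' \<in> N" for g g'
  proof
    assume "K g = K g'"
    then have "(f + fps_X * g) - (f + fps_X * g') \<in> K g"
      using gen_K[of g] gen_K[of g'] by (intro add_subgroup_diff[OF K_sub]) auto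
    then have "g - g' \<in> shift (K g)" by (simp add: shift_def right_diff_distrib)
    then show "g - g' \<in> N" by (simp add: shift_K)
  next
    have sub: "K g \<subseteq> K g'" if d: "g - g' \<in> N" for g g'
    proof
      fix x assume "x \<in> K g"
      then obtain k h where x: "x = of_int k * (f + fps_X * g) + fps_X * h" "h \<in> N"
        by (auto simp: K_def)
      then have "x = of_int k * (f + fps_X * g') + fps_X * (of_int k * (g - g') + h)"
        by (simp add: algebra_simps)
      moreover have "of_int k * (g - g') + h \<in> N"
        using d x N'(1) by (intro add_subgroup_add add_subgroup_of_int_mult)
      ultimately show "x \<in> K g'" unfolding K_def by blast
    qed
    assume h: "g - g' \<in> N"
    then have "g' - g \<in> N" using add_subgroup_uminus[OF N'(1) h] by simp
    with h sub show "K g = K g'" by blast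
  qed
  have fibre_K: "\<exists>g\<in>S. M = K g" if "M \<in> fibre (Suc q) n N d" for M
  proof -
    have M: "M \<in> shift_closed (Suc q) (Suc n)" "shift M = N" "lead M = d"
      using that by (auto simp: fibre_def)
    note M' = shift_closedD[OF M(1)]
    obtain y where y: "y \<in> M" "y $ 0 = int d"
      using lead_dvd_iff[OF M'(1), of "int d"] M by auto
    \<comment> \<open>Any \<open>y \<in> M\<close> with constant term \<open>d\<close> generates
      \<open>M\<close> together with \<open>fps_X * N\<close>; comparing it with \<open>f\<close>
      gives \<open>g\<close>.\<close>
    define g where "g = fps_shift 1 (y - f)"
    have g: "y - f = fps_X * g" unfolding g_def by (rule fps_nth_0_eq_0D) (simp add: y f)
    then have yf: "y = f + fps_X * g" by (simp add: algebra_simps)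
    have "fps_X ^ q * y \<in> shift M" using M'(4)[OF y(1)] by (simp add: shift_def mult.assoc)
    then have "fps_X ^ q * y - fps_X ^ q * f \<in> N" using M f N'(1) by (intro add_subgroup_diff) auto
    then have "g \<in> S" using g mem_S by (simp flip: right_diff_distrib)
    moreover have "M = K g"
    proof (intro equalityI subsetI)
      fix x assume x: "x \<in> M"
      then obtain k where k: "x $ 0 = int d * k"
        using lead_dvd_iff[OF M'(1), of "x $ 0"] M by (auto elim: dvdE)
      have ky: "x - of_int k * y \<in> M" using M'(1) x y by (intro add_subgroup_diff add_subgroup_of_int_mult)
      define h where "h = fps_shift 1 (x - of_int k * y)"
      have h: "x - of_int k * y = fps_X * h" unfolding h_def
        by (rule fps_nth_0_eq_0D) (simp add: y k fps_of_int_mult_nth)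
      then have "h \<in> N" using ky M by (auto simp: shift_def)
      moreover have "x = of_int k * (f + fps_X * g) + fps_X * h" using h yf by (simp add: algebra_simps)
      ultimately show "x \<in> K g" unfolding K_def by blast
    next
      fix x assume "x \<in> K g"
      then obtain k h where x: "x = of_int k * (f + fps_X * g) + fps_X * h" "h \<in> N"
        by (auto simp: K_def)
      have "fps_X * h \<in> M" using x M by (auto simp: shift_def)
      then show "x \<in> M" unfolding x(1) yf[symmetric]
        using M'(1) y by (intro add_subgroup_add add_subgroup_of_int_mult)
    qed
    ultimately show ?thesis by blast
  qed
  have eqK: "fibre (Suc q) n N d = K ` S" using fibre_K K_fibre by auto
  \<comment> \<open>\<open>K\<close> becomes a map on cosets of \<open>N\<close>: by
    \<open>K_eq\<close> its value does not depend on the representative.\<close>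
  define \<kappa> where "\<kappa> C = K (SOME g. g \<in> S \<and> C = (+) g ` N)" for C
  have \<kappa>: "\<kappa> ((+) g ` N) = K g" if "g \<in> S" for g
  proof -
    have "(SOME g'. g' \<in> S \<and> (+) g ` N = (+) g' ` N) \<in> S \<and>
      (+) g ` N = (+) (SOME g'. g' \<in> S \<and> (+) g ` N = (+) g' ` N) ` N"
      using that by (intro someI[of "\<lambda>g'. g' \<in> S \<and> (+) g ` N = (+) g' ` N" g]) simp
    then show ?thesis unfolding \<kappa>_def using coset_eq_iff[OF N'(1)] K_eq by blast
  qed
  have "bij_betw \<kappa> (rel_cosets S N) (K ` S)"
    unfolding bij_betw_def rel_cosets_def inj_on_def
    using \<kappa> K_eq coset_eq_iff[OF N'(1)] by (auto simp: image_image)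
  then have "card (fibre (Suc q) n N d) = card (rel_cosets S N)"
    by (simp add: eqK bij_betw_same_card)
  moreover have "card (rel_cosets S N) * additive_index S =
      (\<Prod>i<Suc q. lead ((shift ^^ i) N)) * additive_index S"
    unfolding S_def
    by (rule trans[OF additive_index_mult[OF N'(1) SG \<open>N \<subseteq> S\<close>, unfolded S_def, symmetric]
          additive_index_shift_funpow[OF N'(1)]])
  ultimately show ?thesis
    using lead_funpow_pos(2)[OF N'(1,3), of "Suc q"] unfolding S_def by (auto simp del: prod.lessThan_Suc funpow.simps(2))
qed

subsection \<open>Infinite sums and the zeta product\<close>

lemma has_sum_times_Sigma:
  fixes f :: "'a \<Rightarrow> complex" and g :: "'b \<Rightarrow> complex"
  assumes f: "(f has_sum S) A" "(\<lambda>x. norm (f x)) summable_on A"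
    and g: "(g has_sum T) B" "(\<lambda>y. norm (g y)) summable_on B"
  shows "((\<lambda>(x, y). f x * g y) has_sum S * T) (A \<times> B)"
    and "(\<lambda>z. norm (case z of (x, y) \<Rightarrow> f x * g y)) summable_on A \<times> B"
proof -
  obtain T' where T': "((\<lambda>y. norm (g y)) has_sum T') B"
    using g(2) summable_on_def by blast
  show abs: "(\<lambda>z. norm (case z of (x, y) \<Rightarrow> f x * g y)) summable_on A \<times> B"
  proof (rule summable_on_SigmaI)
    show "((\<lambda>y. norm (case (x, y) of (x, y) \<Rightarrow> f x * g y)) has_sum norm (f x) * T') B" for x
      using has_sum_cmult_right[OF T', of "norm (f x)"] by (simp add: norm_mult)
    show "(\<lambda>x. norm (f x) * T') summable_on A"
      by (rule summable_on_cmult_left[OF f(2)])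
  qed simp
  show "((\<lambda>(x, y). f x * g y) has_sum S * T) (A \<times> B)"
  proof (rule has_sum_SigmaI)
    show "((\<lambda>y. case (x, y) of (x, y) \<Rightarrow> f x * g y) has_sum f x * T) B" for x
      using has_sum_cmult_right[OF g(1), of "f x"] by simp
    show "((\<lambda>x. f x * T) has_sum S * T) A" by (rule has_sum_cmult_left[OF f(1)])
    show "(\<lambda>(x, y). f x * g y) summable_on A \<times> B" by (rule abs_summable_summable[OF abs])
  qed
qed

text \<open>Sum first over each fibre of \<open>p\<close>, where \<open>F\<close> is constant, then
  over \<open>B\<close>. The same computation with norms gives summability over the disjoint union
  \<open>D\<close> of the fibres, which justifies the regrouping.\<close>

lemma has_sum_finite_fibres:
  fixes F :: "'a \<Rightarrow> complex"
  assumes p: "p ` A \<subseteq> B"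
    and fin: "\<And>b. b \<in> B \<Longrightarrow> finite {a \<in> A. p a = b}"
    and F: "\<And>a. a \<in> A \<Longrightarrow> F a = G (p a)"
    and sum: "((\<lambda>b. of_nat (card {a \<in> A. p a = b}) * G b) has_sum S) B"
    and abs: "(\<lambda>b. norm (of_nat (card {a \<in> A. p a = b}) * G b)) summable_on B"
  shows "(F has_sum S) A" and "(\<lambda>a. norm (F a)) summable_on A"
proof -
  define D where "D = (SIGMA b:B. {a \<in> A. p a = b})"
  have bij: "bij_betw (\<lambda>a. (p a, a)) A D"
    using p by (auto simp: D_def bij_betw_def inj_on_def)
  have fs: "((\<lambda>a. F (snd (b, a))) has_sum of_nat (card {a \<in> A. p a = b}) * G b) {a \<in> A. p a = b}"
    if "b \<in> B" for b
    by (rule has_sum_finiteI[OF fin[OF that]]) (simp add: F)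
  have "((\<lambda>a. norm (F (snd (b, a)))) has_sum norm (of_nat (card {a \<in> A. p a = b}) * G b)) {a \<in> A. p a = b}"
    if "b \<in> B" for b
    by (rule has_sum_finiteI[OF fin[OF that]]) (simp add: F norm_mult)
  then have absD: "(\<lambda>z. norm (F (snd z))) summable_on D"
    unfolding D_def using abs by (rule summable_on_SigmaI) auto
  then show "(\<lambda>a. norm (F a)) summable_on A"
    using summable_on_reindex_bij_betw[OF bij, of "\<lambda>z. norm (F (snd z))"] by simp
  have "((\<lambda>z. F (snd z)) has_sum S) D"
    using abs_summable_summable[OF absD] fs sum unfolding D_def by (intro has_sum_SigmaI)
  then show "(F has_sum S) A"
    using has_sum_reindex_bij_betw[OF bij, of "\<lambda>z. F (snd z)"] by simp
qed

section \<open>Sums over an increasing union of sets\<close>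

lemma finite_subset_incseq:
  assumes mono: "incseq A" and "finite X" "X \<subseteq> (\<Union>n. A n)"
  obtains n :: nat where "X \<subseteq> A n"
proof -
  have "\<exists>n. X \<subseteq> A n"
    using assms(2,3)
  proof (induction X rule: finite_induct)
    case (insert x X)
    then obtain n m where "X \<subseteq> A n" "x \<in> A m" by auto
    then have "insert x X \<subseteq> A (max n m)"
      using incseqD[OF mono, of n "max n m"] incseqD[OF mono, of m "max n m"] by auto
    then show ?case by blast
  qed auto
  then show ?thesis using that by blast
qed

text \<open>A finite set \<open>X\<close> whose finite supersets all have sums near \<open>S\<close>
  lies in some \<open>A n\<close>. For \<open>m \<ge> n\<close> the sum over \<open>A m\<close> is a
  limit of sums over such supersets, hence also near \<open>S\<close>.\<close>

lemma has_sum_incseq_UN: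
  fixes f :: "'a \<Rightarrow> 'b::real_normed_vector"
  assumes mono: "incseq A" and sums: "\<And>n. (f has_sum s n) (A n)"
    and sum: "(f has_sum S) (\<Union>n. A n)"
  shows "s \<longlonglongrightarrow> S"
proof (rule LIMSEQ_I)
  fix e :: real assume "e > 0"
  then have "\<forall>\<^sub>F F in finite_subsets_at_top (\<Union>n. A n). dist (sum f F) S < e / 2"
    using sum[unfolded has_sum_def] by (intro tendstoD) auto
  then obtain X where X: "finite X" "X \<subseteq> (\<Union>n. A n)"
    and Xd: "\<And>Y. finite Y \<Longrightarrow> X \<subseteq> Y \<Longrightarrow> Y \<subseteq> (\<Union>n. A n) \<Longrightarrow> dist (sum f Y) S < e / 2"
    unfolding eventually_finite_subsets_at_top by metis
  then obtain n where n: "X \<subseteq> A n" using finite_subset_incseq[OF mono] by metis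
  have "norm (s m - S) < e" if "m \<ge> n" for m
  proof -
    have XA: "X \<subseteq> A m" using n incseqD[OF mono that] by blast
    have "\<forall>\<^sub>F F in finite_subsets_at_top (A m). dist (sum f F) S \<le> e / 2"
      unfolding eventually_finite_subsets_at_top
    proof (intro exI conjI allI impI)
      fix Y assume "finite Y \<and> X \<subseteq> Y \<and> Y \<subseteq> A m"
      then show "dist (sum f Y) S \<le> e / 2" using Xd[of Y] by (intro less_imp_le) blast
    qed (fact X(1) XA)+
    then have "dist (s m) S \<le> e / 2"
      using sums[of m] unfolding has_sum_def
      by (intro tendsto_upperbound[OF tendsto_dist[OF _ tendsto_const]]) auto
    then show ?thesis using \<open>e > 0\<close> by (simp add: dist_norm)
  qed
  then show "\<exists>n. \<forall>m\<ge>n. norm (s m - S) < e" by blast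
qed

section \<open>The Riemann zeta series and products of its values\<close>

lemma of_nat_powr_mult: "(of_nat (m * n) :: complex) powr z = of_nat m powr z * of_nat n powr z"
  using powr_times_real[of "of_nat m" "of_nat n" z] by simp

lemma norm_of_nat_powr: "n > 0 \<Longrightarrow> norm ((of_nat n :: complex) powr z) = real n powr Re z"
  by (simp add: norm_powr_real_powr)

lemma summable_Suc_powr:
  assumes "x > 1"
  shows "summable (\<lambda>n. real (Suc n) powr - x)"
  using summable_real_powr_iff[of "- x"] assms by (subst summable_Suc_iff) simp

lemma riemann_zeta_has_sum:
  assumes "Re s > 1"
  shows "((\<lambda>n. of_nat (Suc n) powr (- s)) has_sum riemann_zeta s) UNIV"
    and "(\<lambda>n. norm ((of_nat (Suc n) :: complex) powr (- s))) summable_on UNIV"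
proof -
  have n: "summable (\<lambda>n. norm ((of_nat (Suc n) :: complex) powr (- s)))"
    using summable_Suc_powr[OF assms] by (simp add: norm_of_nat_powr del: of_nat_Suc)
  show "((\<lambda>n. of_nat (Suc n) powr (- s)) has_sum riemann_zeta s) UNIV"
    unfolding riemann_zeta_def
    by (intro norm_summable_imp_has_sum n summable_sums summable_norm_cancel)
  show "(\<lambda>n. norm ((of_nat (Suc n) :: complex) powr (- s))) summable_on UNIV"
    using n by (intro summable_nonneg_imp_summable_on) auto
qed

text \<open>After removal of the leading term 1 all bases are at least 2, so the excess
  \<open>t\<close> in the exponent gains a factor \<open>2 powr (- t)\<close>.\<close>

lemma norm_riemann_zeta_minus_1:
  assumes "x > 1" "t \<ge> 0" "Re z = x + t"
  shows "norm (riemann_zeta z - 1) \<le> 2 powr (- t) * (\<Sum>n. real (n + 2) powr - x)"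
proof -
  define f where "f n = (of_nat (n + 2) :: complex) powr (- z)" for n
  have sx: "summable (\<lambda>n. real (n + 2) powr - x)"
    using summable_ignore_initial_segment[OF summable_Suc_powr[OF assms(1)], of 1] by simp
  have nf: "norm (f n) \<le> 2 powr (- t) * real (n + 2) powr - x" for n
  proof -
    have "norm (f n) = real (n + 2) powr (- t) * real (n + 2) powr - x"
      using norm_of_nat_powr[of "n + 2" "- z"] assms(3) by (simp add: f_def algebra_simps flip: powr_add)
    also have "\<dots> \<le> 2 powr (- t) * real (n + 2) powr - x"
      using assms by (intro mult_right_mono powr_mono2') auto
    finally show ?thesis .
  qed
  have sm: "summable (\<lambda>n. 2 powr (- t) * real (n + 2) powr - x)" by (rule summable_mult[OF sx])
  have snf: "summable (\<lambda>n. norm (f n))" 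
    by (rule summable_comparison_test'[OF sm, of 0]) (use nf in auto)
  have "summable (\<lambda>n. (of_nat (Suc n) :: complex) powr (- z))"
  proof (rule summable_norm_cancel)
    show "summable (\<lambda>n. norm ((of_nat (Suc n) :: complex) powr (- z)))"
      using summable_Suc_powr[of "Re z"] assms by (simp add: norm_of_nat_powr del: of_nat_Suc)
  qed
  from suminf_split_head[OF this] have "riemann_zeta z - 1 = suminf f"
    unfolding riemann_zeta_def f_def[abs_def] by (simp add: add.commute)
  also have "norm \<dots> \<le> (\<Sum>n. norm (f n))" by (rule summable_norm[OF snf])
  also have "\<dots> \<le> (\<Sum>n. 2 powr (- t) * real (n + 2) powr - x)" by (rule suminf_le[OF nf snf sm])
  also have "\<dots> = 2 powr (- t) * (\<Sum>n. real (n + 2) powr - x)" by (rule suminf_mult[OF sx])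
  finally show ?thesis .
qed

text \<open>The real part of the argument grows linearly in \<open>j\<close>, so the distance of the
  factors from 1 is bounded by a geometric sequence.\<close>

lemma abs_convergent_prod_riemann_zeta:
  assumes "Re w > 1" "Re \<theta> > 1"
  shows "abs_convergent_prod (\<lambda>j. riemann_zeta (w + of_nat j * (\<theta> - 1)))"
proof (rule summable_imp_abs_convergent_prod)
  define C where "C = (\<Sum>n. real (n + 2) powr - Re w)"
  define c where "c = 2 powr (- (Re \<theta> - 1))"
  have c: "0 < c" "c < 1" using assms by (auto simp: c_def powr_less_one)
  have le: "norm (riemann_zeta (w + of_nat j * (\<theta> - 1)) - 1) \<le> c ^ j * C" for j
  proof -
    have "norm (riemann_zeta (w + of_nat j * (\<theta> - 1)) - 1) \<le> 2 powr (- (real j * (Re \<theta> - 1))) * C"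
      unfolding C_def using assms by (intro norm_riemann_zeta_minus_1) auto
    also have "2 powr (- (real j * (Re \<theta> - 1))) = c ^ j"
      by (simp add: c_def powr_powr algebra_simps flip: powr_realpow)
    finally show ?thesis .
  qed
  have "summable (\<lambda>j. c ^ j * C)" using c by (intro summable_mult2 summable_geometric) auto
  then show "summable (\<lambda>j. norm (riemann_zeta (w + of_nat j * (\<theta> - 1)) - 1))"
    by (rule summable_comparison_test'[where N = 0]) (simp only: real_norm_def abs_norm_cancel le)
qed

lemma riemann_zeta_prod_LIMSEQ:
  assumes "Re w > 1" "Re \<theta> > 1"
  defines "f \<equiv> \<lambda>j. riemann_zeta (w + of_nat j * (\<theta> - 1))"
  shows "f has_prod prodinf f" and "(\<lambda>n. \<Prod>j<n. f j) \<longlonglongrightarrow> prodinf f"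
proof -
  have c: "convergent_prod f"
    unfolding f_def using abs_convergent_prod_riemann_zeta[OF assms(1,2)]
    by (rule abs_convergent_prod_imp_convergent_prod)
  then show "f has_prod prodinf f" by (rule convergent_prod_has_prod)
  show "(\<lambda>n. \<Prod>j<n. f j) \<longlonglongrightarrow> prodinf f"
    using convergent_prod_LIMSEQ[OF c] by (simp add: LIMSEQ_lessThan_iff_atMost)
qed

subsection \<open>The weighted sum over stable subgroups\<close>

text \<open>Passing to \<open>shift N\<close> lowers the index of each leading number by one, and
  the size of the fibre adds 1 to each exponent. As the exponents advance by
  \<open>\<theta>\<close>, the result is again a weight, with \<open>a + \<theta> - 1\<close> for
  \<open>a\<close>.\<close>

definition weight :: "nat \<Rightarrow> complex \<Rightarrow> complex \<Rightarrow> int fps set \<Rightarrow> complex" where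
  "weight r \<theta> a N = of_nat (additive_index N) powr (- (of_nat r * \<theta>)) *
     (\<Prod>i<r. of_nat (lead ((shift ^^ i) N)) powr (- (a + of_nat i * \<theta>)))"

lemma shift_UNIV_funpow: "(shift ^^ k) UNIV = UNIV"
  by (induction k) (auto simp: shift_def)

lemma lead_UNIV: "lead UNIV = 1"
proof (rule lead_eqI)
  show "(\<exists>f\<in>UNIV. f $ 0 = c) \<longleftrightarrow> int 1 dvd c" for c :: int
    using exI[of "\<lambda>f. f $ 0 = c", OF fps_of_int_nth_0] by simp
qed (simp add: add_subgroup_def)

lemma weight_UNIV: "weight r \<theta> a UNIV = 1"
  by (simp add: weight_def shift_UNIV_funpow lead_UNIV)

lemma of_nat_mult_powr:
  "n > 0 \<Longrightarrow> (of_nat n :: complex) * of_nat n powr (- z) = of_nat n powr (- (z - 1))"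
  by (simp add: powr_diff powr_minus field_simps)

text \<open>The weight of a subgroup with \<open>shift\<close> equal to \<open>J\<close> and
  \<open>lead\<close> equal to \<open>d\<close>; in this form it is visibly constant on a
  fibre.\<close>

definition split_weight :: "nat \<Rightarrow> complex \<Rightarrow> complex \<Rightarrow> int fps set \<Rightarrow> nat \<Rightarrow> complex" where
  "split_weight q \<theta> a J d =
     of_nat (d * additive_index J) powr (- (of_nat (Suc q) * \<theta>)) * of_nat d powr (- a) *
     (\<Prod>i<q. of_nat (lead ((shift ^^ i) J)) powr (- (a + of_nat (Suc i) * \<theta>)))"

lemma weight_Suc:
  assumes "add_subgroup N"
  shows "weight (Suc q) \<theta> a N = split_weight q \<theta> a (shift N) (lead N)"
  unfolding weight_def split_weight_def additive_index_shift[OF assms] prod.lessThan_Suc_shift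
  by (simp add: funpow_Suc_right del: funpow.simps(2) of_nat_mult of_nat_Suc)

text \<open>The total weight of the fibre over \<open>J\<close> with leading number
  \<open>Suc e * l q\<close>. The factor \<open>l q\<close> supplies the last factor of the new
  weight, and \<open>Suc e\<close> contributes one term of the zeta series.\<close>

lemma card_times_split_weight:
  assumes "add_subgroup J" "additive_index J > 0"
  shows "of_nat (\<Prod>i<Suc q. lead ((shift ^^ i) J)) *
      split_weight q \<theta> a J (Suc e * lead ((shift ^^ q) J)) =
    weight (Suc q) \<theta> (a + \<theta> - 1) J * of_nat (Suc e) powr (- (of_nat (Suc q) * \<theta> + a))"
proof -
  define l where "l i = lead ((shift ^^ i) J)" for i
  have l: "l i > 0" for i unfolding l_def using lead_funpow_pos(1)[OF assms] .
  define P where "P = (\<Prod>i<q. (of_nat (l i) :: complex) powr (- (a + of_nat (Suc i) * \<theta>)))"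
  define I where "I = (of_nat (additive_index J) :: complex) powr (- (of_nat (Suc q) * \<theta>))"
  have split: "split_weight q \<theta> a J (Suc e * l q) =
      I * of_nat (Suc e) powr (- (of_nat (Suc q) * \<theta> + a)) *
      of_nat (l q) powr (- (of_nat (Suc q) * \<theta> + a)) * P"
    unfolding split_weight_def P_def I_def l_def[symmetric] of_nat_powr_mult minus_add_distrib powr_add
    by (simp only: mult_ac)
  have prod: "of_nat (l i) * (of_nat (l i) :: complex) powr (- (a + of_nat (Suc i) * \<theta>)) =
      of_nat (l i) powr (- (a + \<theta> - 1 + of_nat i * \<theta>))" for i
    unfolding of_nat_mult_powr[OF l] by (simp add: algebra_simps)
  have last: "of_nat (l q) * (of_nat (l q) :: complex) powr (- (of_nat (Suc q) * \<theta> + a)) =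
      of_nat (l q) powr (- (a + \<theta> - 1 + of_nat q * \<theta>))"
    unfolding of_nat_mult_powr[OF l] by (simp add: algebra_simps)
  have "of_nat (\<Prod>i<Suc q. l i) * split_weight q \<theta> a J (Suc e * l q) =
     I * of_nat (Suc e) powr (- (of_nat (Suc q) * \<theta> + a)) *
     ((\<Prod>i<q. of_nat (l i)) * P) * (of_nat (l q) * of_nat (l q) powr (- (of_nat (Suc q) * \<theta> + a)))"
    unfolding split prod.lessThan_Suc of_nat_mult of_nat_prod by (simp only: mult_ac)
  also have "(\<Prod>i<q. of_nat (l i)) * P = (\<Prod>i<q. of_nat (l i) powr (- (a + \<theta> - 1 + of_nat i * \<theta>)))"
    unfolding P_def prod.distrib[symmetric] prod ..
  finally show ?thesis
    unfolding last weight_def l_def[symmetric] I_def prod.lessThan_Suc by (simp only: mult_ac)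
qed

text \<open>Induction on \<open>n\<close> for all \<open>a\<close> at once, since each step changes
  \<open>a\<close>. Grouping the subgroups by \<open>(J, e)\<close> turns the sum into the sum over
  \<open>J\<close> times a zeta series in \<open>e\<close>.\<close>

theorem weight_has_sum:
  assumes "Re \<theta> > 1" "Re a \<ge> 0"
  shows "(weight (Suc q) \<theta> a has_sum
      (\<Prod>j<n. riemann_zeta (of_nat (Suc q) * \<theta> + a + of_nat j * (\<theta> - 1)))) (shift_closed (Suc q) n)"
    and "(\<lambda>N. norm (weight (Suc q) \<theta> a N)) summable_on shift_closed (Suc q) n"
proof -
  have "(weight (Suc q) \<theta> a has_sum
      (\<Prod>j<n. riemann_zeta (of_nat (Suc q) * \<theta> + a + of_nat j * (\<theta> - 1)))) (shift_closed (Suc q) n) \<and>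
    (\<lambda>N. norm (weight (Suc q) \<theta> a N)) summable_on shift_closed (Suc q) n"
    using assms(2)
  proof (induction n arbitrary: a)
    case 0
    then show ?case
      unfolding shift_closed_0 by (auto intro!: has_sum_finiteI simp: weight_UNIV)
  next
    case (Suc n)
    define z where "z = of_nat (Suc q) * \<theta> + a"
    have "Re (a + \<theta> - 1) \<ge> 0" using assms(1) Suc.prems by simp
    note IH = Suc.IH[OF this]
    have "Re z = Re \<theta> + (real q * Re \<theta> + Re a)" by (simp add: z_def algebra_simps)
    moreover have "real q * Re \<theta> + Re a \<ge> 0" using assms(1) Suc.prems by simp
    ultimately have "Re z > 1" using assms(1) by linarith
    note zeta = riemann_zeta_has_sum[OF this]
    define \<delta> where "\<delta> J = lead ((shift ^^ q) J)" for J
    \<comment> \<open>\<open>lead N\<close> is a positive multiple of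
      \<open>\<delta> (shift N)\<close>; subtracting 1 from the quotient lets \<open>e\<close> range
      over all naturals, in step with the zeta series over \<open>Suc e\<close>.\<close>
    define p where "p N = (shift N, lead N div \<delta> (shift N) - 1)" for N
    define G where "G = (\<lambda>(J, e). split_weight q \<theta> a J (Suc e * \<delta> J))"
    let ?A = "shift_closed (Suc q) (Suc n)" and ?B = "shift_closed (Suc q) n \<times> (UNIV :: nat set)"
    have \<delta>: "\<delta> J > 0" if "J \<in> shift_closed (Suc q) n" for J
      unfolding \<delta>_def using lead_funpow_pos(1) shift_closedD(1,3)[OF that] by blast
    have lead_eq: "lead N = Suc (snd (p N)) * \<delta> (shift N)" if N: "N \<in> ?A" for N
    proof -
      have "\<delta> (shift N) dvd lead N" unfolding \<delta>_def using lead_dvd_lead[OF N] .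
      then obtain k where k: "lead N = \<delta> (shift N) * k" by (elim dvdE)
      have "lead N > 0" using lead_pos(1) shift_closedD(1,3)[OF N] by blast
      then have "k > 0" "\<delta> (shift N) > 0" using k by auto
      then show ?thesis using k by (simp add: p_def)
    qed
    have fib: "{N \<in> ?A. p N = (J, e)} = fibre (Suc q) n J (Suc e * \<delta> J)"
      if "J \<in> shift_closed (Suc q) n" for J e
      using lead_eq \<delta>[OF that] by (auto simp: fibre_def p_def)
    have card: "card {N \<in> ?A. p N = (J, e)} = (\<Prod>i<Suc q. lead ((shift ^^ i) J))"
      if J: "J \<in> shift_closed (Suc q) n" for J e
      unfolding fib[OF J] using \<delta>[OF J] by (intro card_fibre[OF J]) (simp_all add: \<delta>_def)
    have cardG: "of_nat (card {N \<in> ?A. p N = b}) * G b =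
        (case b of (J, e) \<Rightarrow> weight (Suc q) \<theta> (a + \<theta> - 1) J * of_nat (Suc e) powr (- z))"
      if B: "b \<in> ?B" for b
    proof -
      obtain J e where b: "b = (J, e)" "J \<in> shift_closed (Suc q) n" using B by blast
      show ?thesis
        unfolding b(1) card[OF b(2)] G_def prod.case z_def \<delta>_def
        by (rule card_times_split_weight[OF shift_closedD(1,3)[OF b(2)]])
    qed
    note prod = has_sum_times_Sigma[OF conjunct1[OF IH] conjunct2[OF IH] zeta]
    have pAB: "p ` ?A \<subseteq> ?B" using shift_shift_closed by (auto simp: p_def)
    have fin: "finite {N \<in> ?A. p N = b}" if B: "b \<in> ?B" for b
    proof -
      obtain J e where b: "b = (J, e)" "J \<in> shift_closed (Suc q) n" using B by blast
      have "(\<Prod>i<Suc q. lead ((shift ^^ i) J)) > 0"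
        using lead_funpow_pos(1)[OF shift_closedD(1,3)[OF b(2)]] by (intro prod_pos) simp
      then show ?thesis using card[OF b(2), of e] unfolding b(1) by (intro card_ge_0_finite) simp
    qed
    have F: "weight (Suc q) \<theta> a N = G (p N)" if N: "N \<in> ?A" for N
      unfolding weight_Suc[OF shift_closedD(1)[OF N]] lead_eq[OF N] by (simp add: G_def p_def)
    note * = has_sum_finite_fibres[where F = "weight (Suc q) \<theta> a" and G = G, OF pAB fin F]
    \<comment> \<open>The factor \<open>j = 0\<close> is the new zeta value; the others form the
      product for \<open>a + \<theta> - 1\<close>.\<close>
    have prod_Suc: "(\<Prod>j<Suc n. riemann_zeta (of_nat (Suc q) * \<theta> + a + of_nat j * (\<theta> - 1))) =
        (\<Prod>j<n. riemann_zeta (of_nat (Suc q) * \<theta> + (a + \<theta> - 1) + of_nat j * (\<theta> - 1))) * riemann_zeta z"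
      unfolding prod.lessThan_Suc_shift z_def by (simp add: algebra_simps)
    have sumG: "((\<lambda>b. of_nat (card {N \<in> ?A. p N = b}) * G b) has_sum
        (\<Prod>j<n. riemann_zeta (of_nat (Suc q) * \<theta> + (a + \<theta> - 1) + of_nat j * (\<theta> - 1))) * riemann_zeta z) ?B"
      using prod(1) by (rule has_sum_cong[THEN iffD1, rotated]) (rule cardG[symmetric])
    have absG: "(\<lambda>b. norm (of_nat (card {N \<in> ?A. p N = b}) * G b)) summable_on ?B"
      using prod(2) by (rule summable_on_cong[THEN iffD1, rotated]) (simp only: cardG)
    show ?case unfolding prod_Suc using *[OF _ _ sumG absG] by blast
  qed
  then show "(weight (Suc q) \<theta> a has_sum
      (\<Prod>j<n. riemann_zeta (of_nat (Suc q) * \<theta> + a + of_nat j * (\<theta> - 1)))) (shift_closed (Suc q) n)"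
    and "(\<lambda>N. norm (weight (Suc q) \<theta> a N)) summable_on shift_closed (Suc q) n"
    by blast+
qed

subsection \<open>Finitely generated modules over \<open>\<int>[[X]]\<close>\<close>

lemma subspace_add_subgroup:
  assumes "module scl" "module.subspace scl N"
  shows "add_subgroup N"
proof -
  interpret module scl by fact
  show ?thesis unfolding add_subgroup_def using assms(2) by (auto intro: subspace_0 subspace_diff)
qed

lemma fps_one_minus_X_power_unit:
  assumes "k > 0"
  obtains u :: "int fps" where "u * (1 - fps_X ^ k) = 1"
proof -
  have "(1 - fps_X ^ k :: int fps) $ 0 = 1" using assms by (simp add: fps_X_power_nth)
  then have "fps_left_inverse (1 - fps_X ^ k :: int fps) 1 * (1 - fps_X ^ k) = 1"
    by (intro fps_left_inverse) simp
  then show ?thesis by (rule that)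
qed

text \<open>Multiplication by \<open>X\<close> is nilpotent on the quotient: two of the cosets of \<open>x, X x, \<dots>, X\<^sup>m x\<close>
  coincide, and \<open>1 - X\<^sup>k\<close> is a unit.\<close>

lemma fps_X_power_scale_mem:
  fixes scl :: "int fps \<Rightarrow> 'm::ab_group_add \<Rightarrow> 'm"
  assumes "module scl" and N: "module.subspace scl N" and fin: "finite (cosets N)"
  shows "scl (fps_X ^ additive_index N) x \<in> N"
proof -
  interpret module scl by fact
  define m where "m = additive_index N"
  note SG = subspace_add_subgroup[OF assms(1) N]
  let ?c = "\<lambda>i. (+) (scl (fps_X ^ i) x) ` N"
  have "\<not> inj_on ?c {..m}"
  proof
    assume "inj_on ?c {..m}"
    then have "card {..m} \<le> card (cosets N)"
      using fin by (intro card_inj_on_le[of ?c]) (auto simp: cosets_def)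
    then show False by (simp add: m_def additive_index_def)
  qed
  then obtain i j where ij: "i < j" "j \<le> m" "?c i = ?c j"
    unfolding inj_on_def by (metis atMost_iff linorder_neqE_nat)
  then have d: "scl (fps_X ^ i) x - scl (fps_X ^ j) x \<in> N" using coset_eq_iff[OF SG] by blast
  obtain u :: "int fps" where u: "u * (1 - fps_X ^ (j - i)) = 1"
    using fps_one_minus_X_power_unit[of "j - i"] ij by auto
  have "fps_X ^ m = fps_X ^ (m - i) * u * (fps_X ^ i * (1 - fps_X ^ (j - i)))"
  proof -
    have "fps_X ^ (m - i) * u * (fps_X ^ i * (1 - fps_X ^ (j - i))) =
        (fps_X ^ (m - i) * fps_X ^ i) * (u * (1 - fps_X ^ (j - i)))" by (simp only: mult_ac)
    then show ?thesis using ij unfolding u by (simp flip: power_add)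
  qed
  also have "fps_X ^ i * (1 - fps_X ^ (j - i)) = fps_X ^ i - (fps_X ^ j :: int fps)"
    using ij by (simp add: right_diff_distrib flip: power_add)
  finally have "scl (fps_X ^ m) x = scl (fps_X ^ (m - i) * u) (scl (fps_X ^ i) x - scl (fps_X ^ j) x)"
    by (simp only: scale_scale scale_left_diff_distrib[symmetric])
  then show ?thesis using subspace_scale[OF N d] by (simp add: m_def)
qed

text \<open>The free module of rank \<open>r\<close> is \<open>\<int>[[X]]\<close> again, with \<open>X\<close> acting as \<open>X\<^sup>r\<close>; \<open>coord r i\<close> is
  the \<open>i\<close>-th coordinate.\<close>

definition coord :: "nat \<Rightarrow> nat \<Rightarrow> int fps \<Rightarrow> int fps" where
  "coord r i f = Abs_fps (\<lambda>k. f $ (k * r + i))"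

lemma coord_diff: "coord r i (f - g) = coord r i f - coord r i g"
  by (simp add: coord_def fps_eq_iff)

lemma coord_X_power:
  assumes "i < r"
  shows "coord r i (fps_X ^ r * f) = fps_X * coord r i f"
proof (rule fps_ext)
  fix k show "coord r i (fps_X ^ r * f) $ k = (fps_X * coord r i f) $ k"
    using assms by (cases k) (simp_all add: coord_def fps_X_power_mult_nth)
qed

lemma coord_interleave:
  assumes "i < r"
  shows "coord r i (Abs_fps (\<lambda>n. g (n mod r) $ (n div r))) = g i"
  using assms by (simp add: coord_def fps_eq_iff)

lemma finitely_generated_surjection:
  fixes scl :: "int fps \<Rightarrow> 'm::ab_group_add \<Rightarrow> 'm"
  assumes "finitely_generated_module scl"
  obtains q and h :: "int fps \<Rightarrow> 'm" where "surj h" "\<And>f g. h (f - g) = h f - h g"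
    "\<And>f. h (fps_X ^ Suc q * f) = scl fps_X (h f)"
proof -
  interpret module scl using assms by (simp add: finitely_generated_module_def)
  obtain B where "finite B" "span B = UNIV" using assms by (auto simp: finitely_generated_module_def)
  \<comment> \<open>Adding 0 keeps the span and makes the generating set nonempty, so the rank is a
    successor.\<close>
  then have B: "finite (insert 0 B)" "span (insert 0 B) = UNIV"
    using span_mono[of B "insert 0 B"] by auto
  obtain q where q: "card (insert 0 B) = Suc q" using B(1) by (metis card_gt_0_iff gr0_implies_Suc insert_not_empty)
  obtain b where b: "bij_betw b {..<Suc q} (insert 0 B)"
    using ex_bij_betw_nat_finite[OF B(1)] unfolding q by (auto simp: atLeast0LessThan)
  define h where "h f = (\<Sum>i<Suc q. scl (coord (Suc q) i f) (b i))" for f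
  show ?thesis
  proof (rule that[of h q])
    show "h (f - g) = h f - h g" for f g
      by (simp add: h_def coord_diff scale_left_diff_distrib sum_subtractf)
    show "h (fps_X ^ Suc q * f) = scl fps_X (h f)" for f
      unfolding h_def scale_sum_right by (intro sum.cong) (simp_all only: lessThan_iff coord_X_power scale_scale)
    show "surj h"
    proof (rule surjI)
      fix y
      have "y \<in> span (insert 0 B)" using B by simp
      then obtain u where u: "y = (\<Sum>v\<in>insert 0 B. scl (u v) v)" unfolding span_finite[OF B(1)] by auto
      then have "y = (\<Sum>i<Suc q. scl (u (b i)) (b i))"
        using sum.reindex_bij_betw[OF b, of "\<lambda>v. scl (u v) v"] by simp
      then have "h (Abs_fps (\<lambda>n. u (b (n mod Suc q)) $ (n div Suc q))) = y"
        unfolding h_def by (auto simp: coord_interleave[where g = "\<lambda>i. u (b i)"] simp del: sum.lessThan_Suc intro!: sum.cong)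
      then show "h ((\<lambda>y. SOME f. h f = y) y) = y" by (rule someI)
    qed
  qed
qed

text \<open>\<open>fps_X ^ m\<close> maps the module into a submodule of index \<open>m\<close>, and
  its counterpart on the ring is \<open>fps_X ^ (r * m)\<close>; this explains the bound.\<close>

lemma vimage_shift_closed:
  fixes scl :: "int fps \<Rightarrow> 'm::ab_group_add \<Rightarrow> 'm" and h :: "int fps \<Rightarrow> 'm"
  assumes "module scl" and surj: "surj h" and diff: "\<And>f g. h (f - g) = h f - h g"
    and X: "\<And>f. h (fps_X ^ r * f) = scl fps_X (h f)"
    and N: "module.subspace scl N" "finite (cosets N)"
  shows "h -` N \<in> shift_closed r (r * additive_index N)"
proof -
  interpret module scl by fact
  have Xk: "h (fps_X ^ (r * k) * f) = scl (fps_X ^ k) (h f)" for k f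
  proof (induction k)
    case (Suc k)
    have "h (fps_X ^ (r * Suc k) * f) = h (fps_X ^ r * (fps_X ^ (r * k) * f))"
      by (simp add: power_add mult_ac)
    then show ?case unfolding X Suc.IH by simp
  qed simp
  note index = additive_index_vimage[OF surj diff subspace_add_subgroup[OF assms(1) N(1)]]
  then have "finite (cosets (h -` N))" using N(2) by (simp flip: additive_index_pos)
  moreover have "fps_X ^ r * f \<in> h -` N" if "f \<in> h -` N" for f
    using that X subspace_scale[OF N(1)] by simp
  moreover have "fps_X ^ (r * additive_index N) * f \<in> h -` N" for f
    using fps_X_power_scale_mem[OF assms(1) N] Xk by simp
  ultimately show ?thesis unfolding shift_closed_def using index(2) by blast
qed

text \<open>The index \<open>m\<close> contributes \<open>m\<close> to the power \<open>-2r\<close>.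
  The leading numbers are at least 1, their product is at most \<open>m\<close>, and their exponents
  are at least \<open>-2r\<close>, so together they contribute no less than the same power
  again.\<close>

lemma weight_lower_bound:
  assumes N: "N \<in> shift_closed r n"
  shows "norm (weight r 2 0 N) \<ge> 1 / real (additive_index N ^ (4 * r))"
proof -
  note N' = shift_closedD[OF N]
  define m where "m = additive_index N"
  define l where "l i = lead ((shift ^^ i) N)" for i
  have m: "m > 0" using N' by (simp add: m_def)
  have l: "l i > 0" for i unfolding l_def using lead_funpow_pos(1)[OF N'(1,3)] .
  have "m = (\<Prod>i<r. l i) * additive_index ((shift ^^ r) N)"
    unfolding m_def l_def by (rule additive_index_shift_funpow[OF N'(1)])
  then have le: "(\<Prod>i<r. l i) \<le> m" using m by (intro dvd_imp_le) auto
  have "real m powr (- (2 * real r)) \<le> real (\<Prod>i<r. l i) powr (- (2 * real r))"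
    using le l by (intro powr_mono2') (auto intro!: prod_pos simp del: of_nat_prod)
  also have "\<dots> = (\<Prod>i<r. real (l i) powr (- (2 * real r)))"
    by (simp add: prod_powr_distrib)
  also have "\<dots> \<le> (\<Prod>i<r. real (l i) powr (- (2 * real i)))"
    using l by (intro prod_mono) (auto intro!: powr_mono simp: Suc_le_eq)
  finally have prod_ge: "real m powr (- (2 * real r)) \<le> (\<Prod>i<r. real (l i) powr (- (2 * real i)))" .
  have "1 / real (m ^ (4 * r)) = real m powr (- (2 * real r)) * real m powr (- (2 * real r))"
    using m powr_realpow[of "real m" "4 * r"] by (simp add: powr_minus_divide flip: powr_add)
  also have "\<dots> \<le> real m powr (- (2 * real r)) * (\<Prod>i<r. real (l i) powr (- (2 * real i)))"
    using prod_ge by (rule mult_left_mono) simp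
  also have "\<dots> = norm (weight r 2 0 N)"
    unfolding weight_def m_def[symmetric] l_def[symmetric] using m l
    by (simp add: norm_mult norm_of_nat_powr mult.commute flip: prod_norm)
  finally show ?thesis by (simp add: m_def)
qed

subsection \<open>Submodule growth and the ideal zeta function\<close>

text \<open>Closure is given only for integer multiples and for \<open>fps_X\<close>. A descending
  induction on \<open>k\<close> splits off the constant term of \<open>a\<close> and passes the rest
  to \<open>Suc k\<close>; at \<open>k = n\<close> membership is automatic.\<close>

lemma mem_shift_closed_mult:
  assumes N: "N \<in> shift_closed 1 n" and f: "f \<in> N"
  shows "a * f \<in> N"
proof -
  note N' = shift_closedD[OF N]
  have "a * (fps_X ^ k * f) \<in> N" if "k \<le> n" for k a
    using that
  proof (induction k arbitrary: a rule: inc_induct)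
    case base
    then show ?case using N'(5)[of "a * f"] by (simp add: mult_ac)
  next
    case (step k)
    have "fps_X ^ k * f \<in> N" using f N'(4) by (induction k) (simp_all add: mult.assoc)
    then have mem: "of_int (a $ 0) * (fps_X ^ k * f) + fps_shift 1 a * (fps_X ^ Suc k * f) \<in> N"
      using N'(1) step.IH by (intro add_subgroup_add add_subgroup_of_int_mult)
    have "a - of_int (a $ 0) = fps_X * fps_shift 1 (a - of_int (a $ 0))"
      by (rule fps_nth_0_eq_0D) (simp add: fps_of_int_nth_0)
    also have "fps_shift 1 (a - of_int (a $ 0)) = fps_shift 1 a"
      by (simp add: fps_eq_iff flip: fps_of_int)
    finally have "a = of_int (a $ 0) + fps_X * fps_shift 1 a" by (simp add: algebra_simps)
    then have "a * (fps_X ^ k * f) = (of_int (a $ 0) + fps_X * fps_shift 1 a) * (fps_X ^ k * f)" by (rule arg_cong)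
    also have "\<dots> = of_int (a $ 0) * (fps_X ^ k * f) + fps_shift 1 a * (fps_X ^ Suc k * f)"
      by (simp add: algebra_simps)
    finally show ?case using mem by simp
  qed
  from this[of 0] show ?thesis by simp
qed

text \<open>Ideals are the submodules of the free module of rank 1, so the preimage lemma applies
  with the identity map.\<close>

lemma finite_index_ideals_eq: "(finite_index_ideals :: int fps set set) = (\<Union>n. shift_closed 1 n)"
proof (intro equalityI subsetI)
  fix I :: "int fps set" assume "I \<in> finite_index_ideals"
  then have I: "module.subspace (*) I" "finite (cosets I)" by (auto simp: finite_index_ideals_def)
  then have "(\<lambda>f. f) -` I \<in> shift_closed 1 (1 * additive_index I)"
    by (intro vimage_shift_closed[OF module_times]) auto
  then show "I \<in> (\<Union>n. shift_closed 1 n)" by auto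
next
  fix I :: "int fps set" assume "I \<in> (\<Union>n. shift_closed 1 n)"
  then obtain n where I: "I \<in> shift_closed 1 n" by blast
  show "I \<in> finite_index_ideals"
    unfolding finite_index_ideals_iff
    using shift_closedD(1,2)[OF I] mem_shift_closed_mult[OF I]
    by (auto intro: add_subgroup_0 add_subgroup_add)
qed

text \<open>The weights for \<open>\<theta> = 2\<close> and \<open>a = 0\<close> sum to a partial
  product of a convergent product, hence are bounded uniformly in \<open>n\<close>, while each
  member of \<open>F\<close> has weight at least \<open>1 / m ^ (4 * Suc q)\<close>.\<close>

lemma card_shift_closed_bound:
  obtains C :: nat where
    "\<And>F m n. finite F \<Longrightarrow> F \<subseteq> shift_closed (Suc q) n \<Longrightarrow> (\<forall>N\<in>F. additive_index N = m) \<Longrightarrow>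
       card F \<le> C * m ^ (4 * Suc q)"
proof -
  define \<zeta> where "\<zeta> j = riemann_zeta (of_nat (Suc q) * 2 + of_nat j * (2 - 1))" for j
  have "Re (of_nat (Suc q) * 2) > (1 :: real)" by simp
  then have "(\<lambda>n. \<Prod>j<n. \<zeta> j) \<longlonglongrightarrow> prodinf \<zeta>"
    using riemann_zeta_prod_LIMSEQ(2)[of "of_nat (Suc q) * 2" 2] by (simp add: \<zeta>_def[abs_def])
  then have "Bseq (\<lambda>n. \<Prod>j<n. \<zeta> j)" by (rule convergentI[THEN convergent_imp_Bseq])
  then obtain K where K: "\<And>n. norm (\<Prod>j<n. \<zeta> j) \<le> K" unfolding Bseq_def by blast
  define C where "C = nat \<lceil>K\<rceil>"
  show ?thesis
  proof (rule that[of C])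
    fix F m n
    assume F: "finite F" "F \<subseteq> shift_closed (Suc q) n" "\<forall>N\<in>F. additive_index N = m"
    let ?w = "weight (Suc q) 2 0"
    show "card F \<le> C * m ^ (4 * Suc q)"
    proof (cases "F = {}")
      case False
      then obtain N where "N \<in> F" by blast
      then have m: "m > 0" using F(2,3) shift_closedD(3)[of N "Suc q" n] by auto
      \<comment> \<open>With real parameters the weight is a nonnegative real, so the sum over a
        finite subset is at most the full sum.\<close>
      have w: "?w N = of_real (norm (?w N))" for N
      proof -
        define x where "x = real (additive_index N) powr (- (real (Suc q) * 2)) *
          (\<Prod>i<Suc q. real (lead ((shift ^^ i) N)) powr (- (real i * 2)))"
        have "?w N = of_real x"
          unfolding weight_def x_def of_real_mult of_real_prod
          by (simp add: powr_of_real[symmetric] del: of_nat_Suc prod.lessThan_Suc)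
        moreover have "x \<ge> 0" unfolding x_def by (intro mult_nonneg_nonneg prod_nonneg) simp_all
        ultimately show ?thesis by simp
      qed
      have hs: "(?w has_sum (\<Prod>j<n. \<zeta> j)) (shift_closed (Suc q) n)"
        using weight_has_sum(1)[of 2 0 q n] by (simp add: \<zeta>_def)
      have "((\<lambda>N. norm (?w N)) has_sum Re (\<Prod>j<n. \<zeta> j)) (shift_closed (Suc q) n)"
        using has_sum_Re[OF hs] w by (metis (no_types, lifting) Re_complex_of_real has_sum_cong)
      then have "(\<Sum>N\<in>F. norm (?w N)) \<le> Re (\<Prod>j<n. \<zeta> j)"
        using F by (intro has_sum_mono_neutral[OF has_sum_finite]) auto
      also have "\<dots> \<le> K" using K complex_Re_le_cmod order_trans by blast
      also have "K \<le> real C" unfolding C_def by (rule real_nat_ceiling_ge)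
      finally have w_le: "(\<Sum>N\<in>F. norm (?w N)) \<le> real C" .
      have "(\<Sum>N\<in>F. 1 / real (m ^ (4 * Suc q))) \<le> (\<Sum>N\<in>F. norm (?w N))"
      proof (rule sum_mono)
        fix N assume "N \<in> F"
        then have "N \<in> shift_closed (Suc q) n" "additive_index N = m" using F by auto
        then show "1 / real (m ^ (4 * Suc q)) \<le> norm (?w N)"
          using weight_lower_bound[of N "Suc q" n] by simp
      qed
      from order_trans[OF this w_le] have "real (card F) \<le> real C * real (m ^ (4 * Suc q))"
        using m by (simp add: divide_le_eq del: of_nat_power power_Suc mult_Suc_right)
      then show ?thesis by (simp only: flip: of_nat_mult of_nat_le_iff)
    qed simp
  qed
qed

text \<open>Preimages under a surjection from a free module are distinct for distinct submodules and
  keep the index, so the bound for stable subgroups carries over.\<close>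

theorem polynomial_submodule_growth_int_fps:
  "polynomial_submodule_growth TYPE(int fps) TYPE('m::ab_group_add)"
  unfolding polynomial_submodule_growth_def
proof (intro allI impI)
  fix scl :: "int fps \<Rightarrow> 'm \<Rightarrow> 'm" assume fg: "finitely_generated_module scl"
  then have mod: "module scl" by (simp add: finitely_generated_module_def)
  obtain q and h :: "int fps \<Rightarrow> 'm" where h: "surj h" "\<And>f g. h (f - g) = h f - h g"
    "\<And>f. h (fps_X ^ Suc q * f) = scl fps_X (h f)"
    using finitely_generated_surjection[OF fg] by metis
  obtain C :: nat where C: "\<And>F m n. finite F \<Longrightarrow> F \<subseteq> shift_closed (Suc q) n \<Longrightarrow>
      (\<forall>N\<in>F. additive_index N = m) \<Longrightarrow> card F \<le> C * m ^ (4 * Suc q)"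
    using card_shift_closed_bound[of q] by metis
  \<comment> \<open>Only finite sets \<open>F\<close> are treated here, as finiteness is still open;
    it follows from the uniformity of the bound.\<close>
  have bound: "card F \<le> C * m ^ (4 * Suc q)"
    if m: "m \<ge> 1" and F: "finite F" "F \<subseteq> submodules_of_index scl m" for m F
  proof -
    have sub: "module.subspace scl N" "finite (cosets N)" "additive_index N = m" if "N \<in> F" for N
      using F(2) that m by (auto simp: submodules_of_index_def simp flip: additive_index_pos)
    have "inj_on (\<lambda>N. h -` N) F"
      by (rule inj_onI) (metis h(1) surj_image_vimage_eq)
    then have "card F = card ((\<lambda>N. h -` N) ` F)" by (simp add: card_image)
    also have "\<dots> \<le> C * m ^ (4 * Suc q)"
    proof (rule C)
      show "(\<lambda>N. h -` N) ` F \<subseteq> shift_closed (Suc q) (Suc q * m)"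
        using vimage_shift_closed[OF mod h sub(1,2)] sub(3) by fastforce
      show "\<forall>K\<in>(\<lambda>N. h -` N) ` F. additive_index K = m"
        using additive_index_vimage(1)[OF h(1,2) subspace_add_subgroup[OF mod sub(1)]] sub(3) by simp
    qed (use F in simp)
    finally show ?thesis .
  qed
  have fin: "finite (submodules_of_index scl m)" if "m \<ge> 1" for m
    using finite_if_finite_subsets_card_bdd[of "submodules_of_index scl m", OF bound[OF that]] by blast
  then show "(\<forall>m\<ge>1. finite (submodules_of_index scl m)) \<and>
      (\<exists>C k :: nat. \<forall>m\<ge>1. card (submodules_of_index scl m) \<le> C * m ^ k)"
    using bound[OF _ _ order_refl] by blast
qed

section \<open>The ideal zeta function as a product\<close>

lemma weight_1:
  assumes "add_subgroup N" "additive_index N > 0"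
  shows "weight 1 s 0 N = of_nat (additive_index N) powr (- s)"
  \<comment> \<open>The only leading number has exponent 0 and contributes 1 because it is positive;
    \<open>0 powr 0\<close> would be 0.\<close>
  using lead_pos(1)[OF assms] by (simp add: weight_def)

text \<open>The sums over \<open>shift_closed 1 n\<close> are the partial products, and these sets
  exhaust the ideals of finite index; absolute summability allows passing to the limit.\<close>

theorem ideal_zeta_int_fps:
  fixes s :: complex
  assumes s: "Re s > 1"
  shows "(\<lambda>I. of_nat (additive_index I) powr (- s) :: complex)
      summable_on (finite_index_ideals :: int fps set set)"
    and "(\<lambda>j::nat. riemann_zeta (of_nat (Suc j) * s - of_nat (Suc j) + 1))
      has_prod ideal_zeta TYPE(int fps) s"
proof -
  let ?I = "finite_index_ideals :: int fps set set"
  define f where "f I = (of_nat (additive_index I) :: complex) powr (- s)" for I :: "int fps set"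
  define \<zeta> where "\<zeta> t j = riemann_zeta (t + of_nat j * (t - 1))" for t j
  have inc: "incseq (shift_closed 1)" by (intro incseq_SucI shift_closed_mono) simp
  have hs: "((\<lambda>I. of_nat (additive_index I) powr (- t)) has_sum (\<Prod>j<n. \<zeta> t j)) (shift_closed 1 n)"
    if "Re t > 1" for t n
  proof -
    have "(weight 1 t 0 has_sum (\<Prod>j<n. \<zeta> t j)) (shift_closed 1 n)"
      using weight_has_sum(1)[OF that, of 0 0 n] by (simp add: \<zeta>_def)
    then show ?thesis
      by (rule has_sum_cong[THEN iffD1, rotated]) (simp only: weight_1 shift_closedD)
  qed
  have norm_f: "complex_of_real (norm (f I)) = of_nat (additive_index I) powr (- of_real (Re s))"
    if "I \<in> shift_closed 1 n" for I n
    using shift_closedD(3)[OF that] by (simp add: f_def norm_of_nat_powr powr_of_real[symmetric])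
  \<comment> \<open>At the real point \<open>\<sigma>\<close> the terms are the norms of the terms
    at \<open>s\<close>, so the bounded partial products at \<open>\<sigma>\<close> bound all finite
    sums of norms.\<close>
  define \<sigma> where "\<sigma> = complex_of_real (Re s)"
  have \<sigma>: "Re \<sigma> > 1" using s by (simp add: \<sigma>_def)
  have "(\<lambda>n. \<Prod>j<n. \<zeta> \<sigma> j) \<longlonglongrightarrow> prodinf (\<zeta> \<sigma>)"
    unfolding \<zeta>_def[abs_def] by (rule riemann_zeta_prod_LIMSEQ(2)[OF \<sigma> \<sigma>])
  then have "Bseq (\<lambda>n. \<Prod>j<n. \<zeta> \<sigma> j)" by (rule convergentI[THEN convergent_imp_Bseq])
  then obtain K where K: "\<And>n. norm (\<Prod>j<n. \<zeta> \<sigma> j) \<le> K" unfolding Bseq_def by blast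
  have "(\<lambda>I. norm (f I)) summable_on ?I"
  proof (rule nonneg_bdd_above_summable_on)
    show "bdd_above (sum (\<lambda>I. norm (f I)) ` {F. F \<subseteq> ?I \<and> finite F})"
    proof (rule bdd_aboveI2)
      fix F assume "F \<in> {F. F \<subseteq> ?I \<and> finite F}"
      then have F: "F \<subseteq> (\<Union>n. shift_closed 1 n)" "finite F" by (simp_all add: finite_index_ideals_eq)
      then obtain n where n: "F \<subseteq> shift_closed 1 n" using finite_subset_incseq[OF inc] by metis
      have "((\<lambda>I. complex_of_real (norm (f I))) has_sum (\<Prod>j<n. \<zeta> \<sigma> j)) (shift_closed 1 n)"
        using hs[OF \<sigma>] by (rule has_sum_cong[THEN iffD1, rotated]) (simp add: norm_f \<sigma>_def)
      then have "((\<lambda>I. norm (f I)) has_sum Re (\<Prod>j<n. \<zeta> \<sigma> j)) (shift_closed 1 n)"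
        using has_sum_Re by fastforce
      then have "(\<Sum>I\<in>F. norm (f I)) \<le> Re (\<Prod>j<n. \<zeta> \<sigma> j)"
        using F n by (intro has_sum_mono_neutral[OF has_sum_finite]) auto
      also have "\<dots> \<le> K" using K complex_Re_le_cmod order_trans by blast
      finally show "(\<Sum>I\<in>F. norm (f I)) \<le> K" .
    qed
  qed simp
  then have sum: "f summable_on ?I" by (rule abs_summable_summable)
  then show "(\<lambda>I. of_nat (additive_index I) powr (- s) :: complex) summable_on ?I"
    by (simp add: f_def[abs_def])
  have "(f has_sum ideal_zeta TYPE(int fps) s) (\<Union>n. shift_closed 1 n)"
    using has_sum_infsum[OF sum] by (simp add: ideal_zeta_def f_def[abs_def] finite_index_ideals_eq)
  then have "(\<lambda>n. \<Prod>j<n. \<zeta> s j) \<longlonglongrightarrow> ideal_zeta TYPE(int fps) s"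
    using hs[OF s] by (intro has_sum_incseq_UN[OF inc, of f]) (simp_all add: f_def[abs_def])
  moreover have "(\<lambda>n. \<Prod>j<n. \<zeta> s j) \<longlonglongrightarrow> prodinf (\<zeta> s)"
    unfolding \<zeta>_def[abs_def] by (rule riemann_zeta_prod_LIMSEQ(2)[OF s s])
  ultimately have "prodinf (\<zeta> s) = ideal_zeta TYPE(int fps) s" using LIMSEQ_unique by blast
  moreover have "\<zeta> s has_prod prodinf (\<zeta> s)"
    unfolding \<zeta>_def[abs_def] by (rule riemann_zeta_prod_LIMSEQ(1)[OF s s])
  \<comment> \<open>Here \<open>s + j (s - 1) = (j + 1) s - (j + 1) + 1\<close>; counting from 0
    turns the index into \<open>Suc j\<close>.\<close>
  moreover have "\<zeta> s = (\<lambda>j. riemann_zeta (of_nat (Suc j) * s - of_nat (Suc j) + 1))"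
    by (simp add: \<zeta>_def fun_eq_iff algebra_simps)
  ultimately show "(\<lambda>j::nat. riemann_zeta (of_nat (Suc j) * s - of_nat (Suc j) + 1))
      has_prod ideal_zeta TYPE(int fps) s" by simp
qed

theorem theorem4p4:
  shows "polynomial_submodule_growth TYPE(int fps) TYPE('m::ab_group_add) \<and>
    (\<forall>s::complex. Re s > 1 \<longrightarrow>
       (\<lambda>I. of_nat (additive_index I) powr (- s) :: complex)
         summable_on (finite_index_ideals :: int fps set set) \<and>
       (\<lambda>j::nat. riemann_zeta (of_nat (Suc j) * s - of_nat (Suc j) + 1))
         has_prod ideal_zeta TYPE(int fps) s)"
  using polynomial_submodule_growth_int_fps ideal_zeta_int_fps by blast

end
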